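(* Fix $T>0$ and let $x_F(t)$ be a solution of the Filippov sliding system $$\dot x=f_F(x):=\frac{f^+(x,0)\,g^-(x,0)-f^-(x,0)\,g^+(x,0)}{g^-(x,0)-g^+(x,0)},$$ and assume that $|x_F(t)|<M$ for $0\le t\le T$. Then there exist $\alpha_0>0$ and a constant $L>0$ such that, for any $0<\alpha\le\alpha_0$, the hysteretic solution $(x_h(t),y_h(t))$ (with hysteresis width $\alpha$) with initial condition $(x_h(0),y_h(0))=(x_0,\mp\alpha)=(x_F(0),\mp\alpha)$ satisfies $$|x_h(t)-x_F(t)|\le L\alpha,\qquad 0\le t\le T.$$
   Context: Let $x\in\mathbb R^{n-1}$, $y\in\mathbb R$, and consider $$\dot x=f(x,y;u),\qquad \dot y=g(x,y;u),$$ where $f,g$ are smooth functions of $(x,y,u)$ and $u=\mathrm{sign}(y)$ in the unregularized (discontinuous) system. Write $f^\pm(x,y)=f(x,y;\pm1)$ and $g^\pm(x,y)=g(x,y;\pm1)$. Standing assumption: $M>0$ is such that, for all $|x|\le M$, $$g(x,0;+1)<0<g(x,0;-1)\quad\text{and}\quad \frac{\partial}{\partial u}g(x,0;u)<0\ \text{ for } u\in[-1,1].$$ Hysteretic solution of width $\alpha>0$: it is the continuous curve $(x_h(t),y_h(t))$ following $\dot x=f(x,y;u)$, $\dot y=g(x,y;u)$ with $u\in\{-1,+1\}$, where $u$ switches as follows: a trajectory with $u=-1$ keeps this value until it reaches the surface $y=+\alpha$, and then switches to $u=+1$; a trajectory with $u=+1$ keeps this value until it reaches the surface $y=-\alpha$,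 and then switches to $u=-1$. When it starts on $y=-\alpha$ it starts with $u=-1$; when it starts on $y=+\alpha$ it starts with $u=+1$. *)

theory Defs
  imports "HOL-Analysis.Analysis"
begin

(* On a finite-dimensional domain, continuity of all iterated directional derivatives, together
   with total differentiability at each order below k, is exactly the class C^k. *)
fun cont_diff :: "nat \<Rightarrow> ('a::real_normed_vector \<Rightarrow> 'b::real_normed_vector) \<Rightarrow> bool" where
  "cont_diff 0 h \<longleftrightarrow> continuous_on UNIV h"
| "cont_diff (Suc k) h \<longleftrightarrow>
     (\<forall>p. h differentiable (at p)) \<and> (\<forall>v. cont_diff k (\<lambda>p. frechet_derivative h (at p) v))"

definition smooth :: "('a::real_normed_vector \<Rightarrow> 'b::real_normed_vector) \<Rightarrow> bool" where
  "smooth h \<longleftrightarrow> (\<forall>k. cont_diff k h)"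

definition solves_with_control ::
  "('a::real_normed_vector \<times> real \<times> real \<Rightarrow> 'a) \<Rightarrow> ('a \<times> real \<times> real \<Rightarrow> real) \<Rightarrow>
   real \<Rightarrow> real set \<Rightarrow> (real \<Rightarrow> 'a) \<Rightarrow> (real \<Rightarrow> real) \<Rightarrow> bool" where
  "solves_with_control f g u I x y \<longleftrightarrow>
     (\<forall>t\<in>I. (x has_vector_derivative f (x t, y t, u)) (at t within I) \<and>
            (y has_real_derivative g (x t, y t, u)) (at t within I))"

(* The solution on [0,T] starting with control u0 (in {-1,1}) on the surface y = u0 * \<alpha>.
   The times \<tau> 1 < ... < \<tau> N are the switching times before T, and u = (-1)^i * u0 on
   [\<tau> i, \<tau> (i+1)]. Control u is left when y first reaches -u * \<alpha>, which is +\<alpha> for u = -1 and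
   -\<alpha> for u = +1. Demanding finitely many switches loses nothing: y is continuous on the
   compact [0,T] and moves a distance 2 * \<alpha> between consecutive switches. *)
definition hysteretic_solution ::
  "('a::real_normed_vector \<times> real \<times> real \<Rightarrow> 'a) \<Rightarrow> ('a \<times> real \<times> real \<Rightarrow> real) \<Rightarrow>
   real \<Rightarrow> real \<Rightarrow> real \<Rightarrow> (real \<Rightarrow> 'a) \<Rightarrow> (real \<Rightarrow> real) \<Rightarrow> bool" where
  "hysteretic_solution f g \<alpha> T u0 x y \<longleftrightarrow>
     continuous_on {0..T} x \<and> continuous_on {0..T} y \<and> y 0 = u0 * \<alpha> \<and>
     (\<exists>(N::nat) (\<tau>::nat \<Rightarrow> real).
        \<tau> 0 = 0 \<and> \<tau> (Suc N) = T \<and> (\<forall>i\<le>N. \<tau> i < \<tau> (Suc i)) \<and>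
        (\<forall>i\<le>N. solves_with_control f g ((-1) ^ i * u0) {\<tau> i..\<tau> (Suc i)} x y) \<and>
        (\<forall>i\<le>N. \<forall>s\<in>{\<tau> i..<\<tau> (Suc i)}. y s \<noteq> - ((-1) ^ i * u0) * \<alpha>) \<and>
        (\<forall>i<N. y (\<tau> (Suc i)) = - ((-1) ^ i * u0) * \<alpha>))"

definition filippov_field ::
  "('a::real_normed_vector \<times> real \<times> real \<Rightarrow> 'a) \<Rightarrow> ('a \<times> real \<times> real \<Rightarrow> real) \<Rightarrow> 'a \<Rightarrow> 'a" where
  "filippov_field f g x =
     (g (x, 0, -1) *\<^sub>R f (x, 0, 1) - g (x, 0, 1) *\<^sub>R f (x, 0, -1)) /\<^sub>R
     (g (x, 0, -1) - g (x, 0, 1))"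

end

theory Submission
  imports Defs
begin

text \<open>
  On the switching surface both values of the control satisfy the same identity
  \<open>f(x,0,u) = f\<^sub>F(x) + g(x,0,u) h(x)\<close> with
  \<open>h = (f\<^sup>- - f\<^sup>+) / (g\<^sup>- - g\<^sup>+)\<close>: the deviation of the velocity from
  the Filippov field is proportional to the velocity of \<open>y\<close>, with a factor that does not depend on
  the control (\<open>filippov_decomposition\<close>). As long as \<open>\<bar>y\<bar> \<le> \<alpha>\<close>, a hysteretic
  solution therefore satisfies \<open>x' = f\<^sub>F(x) + h(x) y' + O(\<alpha>)\<close>, and since
  \<open>y\<close> is small, so is the difference between \<open>h(x) y'\<close> and the total derivative of
  \<open>h(x) y\<close>. Hence \<open>e = x - y h(x) - x\<^sub>F\<close> is continuous across the switches,
  starts at size \<open>O(\<alpha>)\<close> and satisfies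
  \<open>\<bar>e'\<bar> \<le> C (\<bar>e\<bar> + \<alpha>)\<close> in every phase
  (\<open>corrected_error_derivative\<close>). Gronwall's inequality gives \<open>e = O(\<alpha>)\<close> on
  \<open>[0,T]\<close>, with a constant that is independent of the number of switches; a count of the
  switches, or an average over the switching cycles, never enters.

  Two confinement arguments justify the bounds. The sign of \<open>g\<close> near the surface makes the
  vector field point inward at the level \<open>y = u\<alpha>\<close> from which a phase with control \<open>u\<close> starts, so that
  \<open>\<bar>y\<bar> \<le> \<alpha>\<close> holds while \<open>\<bar>x\<bar> \<le> M\<close>
  (\<open>confined_until_exit\<close>); and a first time at which \<open>\<bar>x\<bar> = M\<close> is
  excluded by the estimate up to that time, because \<open>x\<^sub>F\<close> keeps a positive distance from
  the sphere of radius \<open>M\<close> (\<open>tracking\<close>).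

  For the existence of hysteretic solutions the fields are composed with the nearest-point map onto the
  cylinder \<open>\<bar>x\<bar> \<le> M, \<bar>y\<bar> \<le> \<eta>\<close>. The resulting fields
  are bounded and globally Lipschitz, so that each phase is solvable for all time
  (\<open>Picard_Lindelof_global\<close>), and since \<open>y\<close> needs a minimal time to cross the strip,
  finitely many phases fill \<open>[0,T]\<close> (\<open>hysteretic_solution_exists\<close>). The estimate
  applies to this solution as well, because it only uses the values of the fields on the cylinder; it
  shows that the solution never leaves the cylinder, and so it solves the original system.
\<close>

section \<open>Initial value problems for Lipschitz fields\<close>

text \<open>
  The integral equation is solved for \<open>w(t) = exp(-kt) z(t)\<close> with \<open>k > L\<close>. In this
  exponentially weighted form the Picard operator contracts with factor \<open>L / k < 1\<close> in the
  supremum norm, however long the interval is, so that a single application of Banach's fixed point theorem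
  replaces the usual continuation from short intervals.
\<close>
lemma Picard_Lindelof_global:
  fixes F :: "'a::banach \<Rightarrow> 'a"
  assumes lip: "L-lipschitz_on UNIV F" and T: "0 \<le> T"
  obtains z where "z 0 = z\<^sub>0"
    "\<And>t. t \<in> {0..T} \<Longrightarrow> (z has_vector_derivative F (z t)) (at t within {0..T})"
proof -
  \<comment> \<open>any weight above \<open>L\<close> makes the operator \<open>P\<close> below a contraction\<close>
  define k where "k = L + 1"
  have L0: "0 \<le> L" using lip lipschitz_on_nonneg by blast
  have k0: "0 < k" using L0 by (simp add: k_def)
  have F_cont: "continuous_on UNIV F" using lip by (rule lipschitz_on_continuous_on)
  define G where "G = (\<lambda>(w::real \<Rightarrow>\<^sub>C 'a) s. F (exp (k * s) *\<^sub>R apply_bcontfun w s))"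
  define V where "V = (\<lambda>w t. exp (- k * t) *\<^sub>R (z\<^sub>0 + integral {0..t} (G w)))"
  have G_cont: "continuous_on A (G w)" for A w
    unfolding G_def
    by (intro continuous_on_compose2[OF F_cont] continuous_intros) auto
  have V_cont: "continuous_on (cbox 0 T) (V w)" for w
    unfolding V_def cbox_interval
    by (intro continuous_intros indefinite_integral_continuous_1 integrable_continuous_real G_cont)
  \<comment> \<open>extending \<open>V w\<close> constantly beyond \<open>[0,T]\<close> turns it into a point of the complete space
    of bounded continuous functions\<close>
  have "\<forall>w. \<exists>v::real \<Rightarrow>\<^sub>C 'a. (\<forall>t\<in>cbox 0 T. apply_bcontfun v t = V w t) \<and> (\<forall>t. apply_bcontfun v t = V w (clamp 0 T t))"
    by (metis continuous_on_cbox_bcontfunE[OF V_cont])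
  then obtain P :: "(real \<Rightarrow>\<^sub>C 'a) \<Rightarrow> (real \<Rightarrow>\<^sub>C 'a)"
    where P_on: "\<And>w t. t \<in> cbox 0 T \<Longrightarrow> apply_bcontfun (P w) t = V w t"
      and P_clamp: "\<And>w t. apply_bcontfun (P w) t = V w (clamp 0 T t)" by metis
  have V_dist: "dist (V v t) (V w t) \<le> L / k * dist v w" if t: "t \<in> {0..T}" for v w t
  proof -
    let ?d = "dist v w"
    have exp_int: "((\<lambda>s. L * ?d * exp (k * s)) has_integral
        (L * ?d * exp (k * t) / k - L * ?d * exp (k * 0) / k)) {0..t}"
      using t k0
      by (intro fundamental_theorem_of_calculus)
        (auto intro!: derivative_eq_intros
              simp: has_real_derivative_iff_has_vector_derivative[symmetric])
    have G_diff: "norm (G v s - G w s) \<le> L * ?d * exp (k * s)" for s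
    proof -
      have "norm (G v s - G w s) \<le> L * dist (exp (k * s) *\<^sub>R apply_bcontfun v s) (exp (k * s) *\<^sub>R apply_bcontfun w s)"
        unfolding G_def dist_norm[symmetric] by (rule lipschitz_onD[OF lip]) auto
      also have "\<dots> = L * (exp (k * s) * dist (apply_bcontfun v s) (apply_bcontfun w s))"
        by (simp add: dist_norm scaleR_diff_right[symmetric])
      also have "\<dots> \<le> L * (exp (k * s) * ?d)"
        using L0 by (intro mult_left_mono dist_bounded) auto
      finally show ?thesis by (simp add: mult_ac)
    qed
    have G_int: "G u integrable_on {0..t}" for u
      by (rule integrable_continuous_real[OF G_cont])
    have "norm (integral {0..t} (G v) - integral {0..t} (G w))
        = norm (integral {0..t} (\<lambda>s. G v s - G w s))"
      by (simp add: integral_diff[OF G_int G_int])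
    also have "\<dots> \<le> integral {0..t} (\<lambda>s. L * ?d * exp (k * s))"
      by (rule integral_norm_bound_integral)
        (use G_int G_diff exp_int in \<open>auto intro: integrable_diff\<close>)
    also have "\<dots> = L * ?d * exp (k * t) / k - L * ?d / k"
      using integral_unique[OF exp_int] by simp
    also have "\<dots> \<le> L * ?d * exp (k * t) / k"
      using L0 k0 by simp
    finally have "norm (integral {0..t} (G v) - integral {0..t} (G w)) \<le> L * ?d * exp (k * t) / k" .
    then have "exp (- k * t) * norm (integral {0..t} (G v) - integral {0..t} (G w))
        \<le> exp (- k * t) * (L * ?d * exp (k * t) / k)"
      by (rule mult_left_mono) simp
    also have "\<dots> = L / k * ?d"
      by (simp add: exp_minus field_simps)
    finally show ?thesis
      by (simp add: V_def dist_norm scaleR_diff_right[symmetric])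
  qed
  have "\<exists>!w. P w = w"
  proof (rule banach_fix_type)
    show "0 \<le> L / k" "L / k < 1" using L0 k0 by (auto simp: k_def)
    show "\<forall>v w. dist (P v) (P w) \<le> L / k * dist v w"
      using V_dist clamp_in_interval[of 0 T] T by (auto intro!: dist_bound simp: P_clamp)
  qed
  then obtain w where w: "P w = w" by blast
  define z where "z = (\<lambda>t. exp (k * t) *\<^sub>R apply_bcontfun w t)"
  have z_eq: "z t = z\<^sub>0 + integral {0..t} (\<lambda>s. F (z s))" if "t \<in> {0..T}" for t
    using P_on[of t w] that
    by (simp add: w z_def V_def G_def[abs_def] exp_minus)
  show ?thesis
  proof
    show "z 0 = z\<^sub>0" using z_eq[of 0] T by simp
    fix t assume t: "t \<in> {0..T}"
    have "continuous_on {0..T} (\<lambda>s. F (z s))"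
      using G_cont[of _ w] by (simp add: G_def[abs_def] z_def)
    from integral_has_vector_derivative[OF this t]
    have "((\<lambda>t. z\<^sub>0 + integral {0..t} (\<lambda>s. F (z s))) has_vector_derivative F (z t)) (at t within {0..T})"
      by (auto intro!: derivative_eq_intros simp: zero_prod_def)
    then show "(z has_vector_derivative F (z t)) (at t within {0..T})"
      by (rule has_vector_derivative_transform[OF t, rotated]) (simp add: z_eq)
  qed
qed

section \<open>Hysteretic solutions\<close>

lemma control_system_solution:
  fixes f :: "'a::banach \<times> real \<times> real \<Rightarrow> 'a"
  assumes "L-lipschitz_on UNIV (\<lambda>(x, y). (f (x, y, u), g (x, y, u)))" "0 \<le> T"
  obtains x y where "x 0 = x\<^sub>0" "y 0 = y\<^sub>0" "solves_with_control f g u {0..T} x y"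
proof -
  obtain z where z0: "z 0 = (x\<^sub>0, y\<^sub>0)"
    and z: "\<And>t. t \<in> {0..T} \<Longrightarrow> (z has_vector_derivative
      (\<lambda>(x, y). (f (x, y, u), g (x, y, u))) (z t)) (at t within {0..T})"
    using Picard_Lindelof_global[OF assms] by blast
  have "solves_with_control f g u {0..T} (\<lambda>t. fst (z t)) (\<lambda>t. snd (z t))"
    unfolding solves_with_control_def
    using bounded_linear.has_vector_derivative[OF bounded_linear_fst z]
      bounded_linear.has_vector_derivative[OF bounded_linear_snd z]
    by (simp add: case_prod_beta has_real_derivative_iff_has_vector_derivative)
  then show ?thesis using that[of "\<lambda>t. fst (z t)" "\<lambda>t. snd (z t)"] z0 by simp
qed

lemma solves_with_control_subset:
  assumes "solves_with_control f g u I x y" "J \<subseteq> I"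
  shows "solves_with_control f g u J x y"
  using assms unfolding solves_with_control_def
  by (meson has_vector_derivative_within_subset DERIV_subset subsetD)

lemma solves_with_control_cong:
  assumes "\<And>t. t \<in> I \<Longrightarrow> x t = x' t" "\<And>t. t \<in> I \<Longrightarrow> y t = y' t"
    and "\<And>t. t \<in> I \<Longrightarrow> f (x t, y t, u) = f' (x t, y t, u)"
    and "\<And>t. t \<in> I \<Longrightarrow> g (x t, y t, u) = g' (x t, y t, u)"
    and "solves_with_control f g u I x y"
  shows "solves_with_control f' g' u I x' y'"
  unfolding solves_with_control_def
proof (intro ballI conjI)
  fix t assume t: "t \<in> I"
  have "(x has_vector_derivative f' (x' t, y' t, u)) (at t within I)"
    "(y has_vector_derivative g' (x' t, y' t, u)) (at t within I)"
    using assms t by (auto simp: solves_with_control_def has_real_derivative_iff_has_vector_derivative)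
  then show "(x' has_vector_derivative f' (x' t, y' t, u)) (at t within I)"
    "(y' has_real_derivative g' (x' t, y' t, u)) (at t within I)"
    unfolding has_real_derivative_iff_has_vector_derivative
    using assms(1,2) t by (auto elim!: has_vector_derivative_transform[rotated 2])
qed

lemma solves_with_control_shift:
  assumes "solves_with_control f g u {a..b} x y"
  shows "solves_with_control f g u {s + a..s + b} (\<lambda>t. x (t - s)) (\<lambda>t. y (t - s))"
  unfolding solves_with_control_def
proof (intro ballI conjI)
  have img: "(\<lambda>t. t - s) ` {s + a..s + b} = {a..b}"
    by (simp add: image_diff_atLeastAtMost)
  fix t assume t: "t \<in> {s + a..s + b}"
  have shift: "((\<lambda>t. t - s) has_vector_derivative 1) (at t within {s + a..s + b})"
    by (auto intro!: derivative_eq_intros)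
  have x: "(x has_vector_derivative f (x (t - s), y (t - s), u)) (at (t - s) within {a..b})"
    and y: "(y has_vector_derivative g (x (t - s), y (t - s), u)) (at (t - s) within {a..b})"
    using assms t by (auto simp: solves_with_control_def has_real_derivative_iff_has_vector_derivative)
  show "((\<lambda>t. x (t - s)) has_vector_derivative f (x (t - s), y (t - s), u)) (at t within {s + a..s + b})"
    using vector_diff_chain_within[OF shift, unfolded img, OF x] by (simp add: o_def)
  show "((\<lambda>t. y (t - s)) has_real_derivative g (x (t - s), y (t - s), u)) (at t within {s + a..s + b})"
    using vector_diff_chain_within[OF shift, unfolded img, OF y]
    by (simp add: o_def has_real_derivative_iff_has_vector_derivative)
qed

lemma solves_with_control_continuous_on:
  assumes "solves_with_control f g u I x y"
  shows "continuous_on I x" "continuous_on I y"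
proof -
  show "continuous_on I x"
    using assms by (intro continuous_on_vector_derivative) (auto simp: solves_with_control_def)
  show "continuous_on I y"
    using assms by (intro continuous_on_vector_derivative)
      (auto simp: solves_with_control_def has_real_derivative_iff_has_vector_derivative)
qed

text \<open>
  The set of hitting times is compact, hence has a least element.
\<close>
lemma first_hitting_time:
  fixes y :: "real \<Rightarrow> real"
  assumes "continuous_on {a..b} y" "s \<in> {a..b}" "y s = c"
  obtains \<sigma> where "a \<le> \<sigma>" "\<sigma> \<le> s" "y \<sigma> = c" "\<And>r. a \<le> r \<Longrightarrow> r < \<sigma> \<Longrightarrow> y r \<noteq> c"
proof -
  have "compact {r \<in> {a..b}. y r = c}"
    using continuous_closed_preimage_constant[OF assms(1), of c]
    by (auto simp: compact_eq_bounded_closed intro: bounded_subset[OF bounded_closed_interval])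
  with assms obtain \<sigma> where \<sigma>: "\<sigma> \<in> {r \<in> {a..b}. y r = c}" "\<And>r. r \<in> {r \<in> {a..b}. y r = c} \<Longrightarrow> \<sigma> \<le> r"
    using compact_attains_inf[of "{r \<in> {a..b}. y r = c}"] by blast
  show ?thesis
  proof (rule that[of \<sigma>])
    show "y r \<noteq> c" if "a \<le> r" "r < \<sigma>" for r
      using \<sigma>(1) \<sigma>(2)[of r] that by auto
  qed (use \<sigma> assms in auto)
qed

text \<open>
  The last two facts follow from the monotonicity of the switching times; they give access to bounds
  that hold on \<open>[0,T]\<close> inside each phase.
\<close>
lemma hysteretic_solutionE:
  assumes "hysteretic_solution f g \<alpha> T u\<^sub>0 x y"
  obtains N \<tau> where "continuous_on {0..T} x" "continuous_on {0..T} y" "y 0 = u\<^sub>0 * \<alpha>"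
    "\<tau> 0 = 0" "\<tau> (Suc N) = T" "\<And>i. i \<le> N \<Longrightarrow> \<tau> i < \<tau> (Suc i)"
    "\<And>i. i \<le> N \<Longrightarrow> solves_with_control f g ((-1) ^ i * u\<^sub>0) {\<tau> i..\<tau> (Suc i)} x y"
    "\<And>i s. i \<le> N \<Longrightarrow> \<tau> i \<le> s \<Longrightarrow> s < \<tau> (Suc i) \<Longrightarrow> y s \<noteq> - ((-1) ^ i * u\<^sub>0) * \<alpha>"
    "\<And>i. i < N \<Longrightarrow> y (\<tau> (Suc i)) = - ((-1) ^ i * u\<^sub>0) * \<alpha>"
    "\<And>i. i \<le> N \<Longrightarrow> 0 \<le> \<tau> i" "\<And>i. i \<le> N \<Longrightarrow> \<tau> (Suc i) \<le> T"
proof -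
  obtain N \<tau> where H: "continuous_on {0..T} x" "continuous_on {0..T} y" "y 0 = u\<^sub>0 * \<alpha>"
    "\<tau> 0 = 0" "\<tau> (Suc N) = T" "\<forall>i\<le>N. \<tau> i < \<tau> (Suc i)"
    "\<forall>i\<le>N. solves_with_control f g ((-1) ^ i * u\<^sub>0) {\<tau> i..\<tau> (Suc i)} x y"
    "\<forall>i\<le>N. \<forall>s\<in>{\<tau> i..<\<tau> (Suc i)}. y s \<noteq> - ((-1) ^ i * u\<^sub>0) * \<alpha>"
    "\<forall>i<N. y (\<tau> (Suc i)) = - ((-1) ^ i * u\<^sub>0) * \<alpha>"
    using assms unfolding hysteretic_solution_def by (elim conjE exE) (rule that)
  have mono: "\<tau> i \<le> \<tau> j" if "i \<le> j" "j \<le> Suc N" for i j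
    using that
  proof (induction j rule: dec_induct)
    case (step j)
    then have "\<tau> j < \<tau> (Suc j)" using H(6) by simp
    with step show ?case by simp
  qed simp
  show thesis
  proof (rule that[of \<tau> N])
    show "0 \<le> \<tau> i" if "i \<le> N" for i using mono[of 0 i] H(4) that by simp
    show "\<tau> (Suc i) \<le> T" if "i \<le> N" for i using mono[of "Suc i" "Suc N"] H(5) that by simp
  qed (use H in simp_all)
qed

text \<open>
  A hysteretic solution only sees the fields along its own graph, so they may be changed elsewhere.
\<close>
lemma hysteretic_solution_cong:
  assumes hyst: "hysteretic_solution f' g' \<alpha> T u\<^sub>0 x y" and u\<^sub>0: "u\<^sub>0 \<in> {-1, 1}"
    and agree: "\<And>t u. t \<in> {0..T} \<Longrightarrow> u \<in> {-1, 1} \<Longrightarrow>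
      f' (x t, y t, u) = f (x t, y t, u) \<and> g' (x t, y t, u) = g (x t, y t, u)"
  shows "hysteretic_solution f g \<alpha> T u\<^sub>0 x y"
proof -
  obtain N \<tau> where \<tau>: "continuous_on {0..T} x" "continuous_on {0..T} y" "y 0 = u\<^sub>0 * \<alpha>"
    "\<tau> 0 = 0" "\<tau> (Suc N) = T" "\<And>i. i \<le> N \<Longrightarrow> \<tau> i < \<tau> (Suc i)"
    and sol: "\<And>i. i \<le> N \<Longrightarrow> solves_with_control f' g' ((-1) ^ i * u\<^sub>0) {\<tau> i..\<tau> (Suc i)} x y"
    and exit: "\<And>i s. i \<le> N \<Longrightarrow> \<tau> i \<le> s \<Longrightarrow> s < \<tau> (Suc i) \<Longrightarrow> y s \<noteq> - ((-1) ^ i * u\<^sub>0) * \<alpha>"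
    "\<And>i. i < N \<Longrightarrow> y (\<tau> (Suc i)) = - ((-1) ^ i * u\<^sub>0) * \<alpha>"
    and \<tau>_bounds: "\<And>i. i \<le> N \<Longrightarrow> 0 \<le> \<tau> i" "\<And>i. i \<le> N \<Longrightarrow> \<tau> (Suc i) \<le> T"
    by (rule hysteretic_solutionE[OF hyst]) (rule that)
  have "solves_with_control f g ((-1) ^ i * u\<^sub>0) {\<tau> i..\<tau> (Suc i)} x y" if i: "i \<le> N" for i
  proof (rule solves_with_control_cong[OF refl refl _ _ sol[OF i]])
    fix t assume "t \<in> {\<tau> i..\<tau> (Suc i)}"
    then have t: "t \<in> {0..T}" using \<tau>_bounds[OF i] by auto
    have u: "(-1) ^ i * u\<^sub>0 \<in> {-1, 1}" using u\<^sub>0 by (cases "even i") auto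
    show "f' (x t, y t, (-1) ^ i * u\<^sub>0) = f (x t, y t, (-1) ^ i * u\<^sub>0)"
      "g' (x t, y t, (-1) ^ i * u\<^sub>0) = g (x t, y t, (-1) ^ i * u\<^sub>0)"
      using agree[OF t u] by auto
  qed
  then show ?thesis
    unfolding hysteretic_solution_def using \<tau> exit
    by (intro conjI exI[of _ N] exI[of _ \<tau>]) auto
qed

lemma hysteretic_solution_single_phase:
  assumes "0 < T" "solves_with_control f g u\<^sub>0 {0..T} x y" "y 0 = u\<^sub>0 * \<alpha>"
    and "\<And>s. 0 \<le> s \<Longrightarrow> s < T \<Longrightarrow> y s \<noteq> - u\<^sub>0 * \<alpha>"
  shows "hysteretic_solution f g \<alpha> T u\<^sub>0 x y"
  unfolding hysteretic_solution_def
proof (intro conjI exI)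
  let ?\<tau> = "\<lambda>i::nat. if i = 0 then 0 else T"
  show "?\<tau> 0 = 0" "?\<tau> (Suc 0) = T" by auto
qed (use assms solves_with_control_continuous_on[OF assms(2)] in auto)

text \<open>
  The system is autonomous, so what happens after the first switch is a hysteretic solution on a shorter
  interval that starts on the opposite surface with the opposite control. This is the inductive step for
  constructing solutions.
\<close>
lemma hysteretic_solution_prepend_phase:
  assumes \<sigma>: "0 < \<sigma>" "\<sigma> < T"
    and phase: "solves_with_control f g u\<^sub>0 {0..\<sigma>} x y" "y 0 = u\<^sub>0 * \<alpha>" "y \<sigma> = - u\<^sub>0 * \<alpha>"
      "\<And>s. 0 \<le> s \<Longrightarrow> s < \<sigma> \<Longrightarrow> y s \<noteq> - u\<^sub>0 * \<alpha>"
    and rest: "hysteretic_solution f g \<alpha> (T - \<sigma>) (- u\<^sub>0) x' y'" "x' 0 = x \<sigma>"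
  shows "hysteretic_solution f g \<alpha> T u\<^sub>0
    (\<lambda>t. if t \<le> \<sigma> then x t else x' (t - \<sigma>)) (\<lambda>t. if t \<le> \<sigma> then y t else y' (t - \<sigma>))"
    (is "hysteretic_solution f g \<alpha> T u\<^sub>0 ?X ?Y")
proof -
  obtain N \<tau> where rest':
    "continuous_on {0..T - \<sigma>} x'" "continuous_on {0..T - \<sigma>} y'" "y' 0 = - u\<^sub>0 * \<alpha>"
    "\<tau> 0 = 0" "\<tau> (Suc N) = T - \<sigma>" "\<And>i. i \<le> N \<Longrightarrow> \<tau> i < \<tau> (Suc i)"
    "\<And>i. i \<le> N \<Longrightarrow> solves_with_control f g ((-1) ^ i * - u\<^sub>0) {\<tau> i..\<tau> (Suc i)} x' y'"
    "\<And>i s. i \<le> N \<Longrightarrow> \<tau> i \<le> s \<Longrightarrow> s < \<tau> (Suc i) \<Longrightarrow> y' s \<noteq> - ((-1) ^ i * - u\<^sub>0) * \<alpha>"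
    "\<And>i. i < N \<Longrightarrow> y' (\<tau> (Suc i)) = - ((-1) ^ i * - u\<^sub>0) * \<alpha>"
    and \<tau>_nonneg: "\<And>i. i \<le> N \<Longrightarrow> 0 \<le> \<tau> i"
    by (rule hysteretic_solutionE[OF rest(1)]) (rule that)
  \<comment> \<open>the two formulas agree at the switch itself, so the second one holds from \<open>\<sigma>\<close> on\<close>
  have late: "?X t = x' (t - \<sigma>)" "?Y t = y' (t - \<sigma>)" if "\<sigma> \<le> t" for t
    using that rest(2) rest'(3) phase(3) by (auto simp: not_le)
  have cont: "continuous_on {0..T} (\<lambda>t. if t \<le> \<sigma> then p t else q (t - \<sigma>))"
    if "continuous_on {0..\<sigma>} p" "continuous_on {0..T - \<sigma>} q" "p \<sigma> = q 0"
    for p q :: "real \<Rightarrow> 'z::topological_space"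
  proof -
    have "continuous_on ({0..\<sigma>} \<union> {\<sigma>..T}) (\<lambda>t. if t \<le> \<sigma> then p t else q (t - \<sigma>))"
    proof (rule continuous_on_If)
      show "continuous_on {\<sigma>..T} (\<lambda>t. q (t - \<sigma>))"
        by (rule continuous_on_compose2[OF that(2)]) (auto intro!: continuous_intros)
    qed (use that in auto)
    moreover have "{0..\<sigma>} \<union> {\<sigma>..T} = {0..T}" using \<sigma> by auto
    ultimately show ?thesis by simp
  qed
  define \<tau>' where "\<tau>' i = (case i of 0 \<Rightarrow> 0 | Suc j \<Rightarrow> \<sigma> + \<tau> j)" for i
  have \<tau>'_simps: "\<tau>' 0 = 0" "\<tau>' (Suc j) = \<sigma> + \<tau> j" for j by (auto simp: \<tau>'_def)
  show ?thesis
    unfolding hysteretic_solution_def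
  proof (intro conjI exI[of _ "Suc N"] exI[of _ \<tau>'] allI impI ballI)
    show "continuous_on {0..T} ?X" "continuous_on {0..T} ?Y"
      using solves_with_control_continuous_on[OF phase(1)] rest' rest(2) phase(3)
      by (auto intro!: cont)
    show "?Y 0 = u\<^sub>0 * \<alpha>" using \<sigma> phase by simp
    show "\<tau>' 0 = 0" "\<tau>' (Suc (Suc N)) = T" using rest' by (auto simp: \<tau>'_simps)
    show "\<tau>' i < \<tau>' (Suc i)" if "i \<le> Suc N" for i
      using that rest'(4,6) \<sigma> by (cases i) (auto simp: \<tau>'_simps)
    show "solves_with_control f g ((-1) ^ i * u\<^sub>0) {\<tau>' i..\<tau>' (Suc i)} ?X ?Y" if "i \<le> Suc N" for i
    proof (cases i)
      case 0
      show ?thesis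
        by (rule solves_with_control_cong[OF _ _ refl refl, where x = x and y = y])
          (use 0 phase(1) rest'(4) in \<open>auto simp: \<tau>'_simps\<close>)
    next
      case (Suc j)
      show ?thesis
      proof (rule solves_with_control_cong[OF _ _ refl refl])
        show "solves_with_control f g ((-1) ^ i * u\<^sub>0) {\<tau>' i..\<tau>' (Suc i)} (\<lambda>t. x' (t - \<sigma>)) (\<lambda>t. y' (t - \<sigma>))"
          using solves_with_control_shift[OF rest'(7)[of j], of \<sigma>] that Suc by (simp add: \<tau>'_simps)
      next
        fix t assume "t \<in> {\<tau>' i..\<tau>' (Suc i)}"
        then have "\<sigma> \<le> t" using \<tau>_nonneg[of j] that Suc by (simp add: \<tau>'_simps)
        then show "x' (t - \<sigma>) = ?X t" "y' (t - \<sigma>) = ?Y t" using late by metis+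
      qed
    qed
    show "?Y s \<noteq> - ((-1) ^ i * u\<^sub>0) * \<alpha>" if "i \<le> Suc N" "s \<in> {\<tau>' i..<\<tau>' (Suc i)}" for i s
    proof (cases i)
      case 0
      then show ?thesis using that phase(4)[of s] rest'(4) by (simp add: \<tau>'_simps)
    next
      case (Suc j)
      then have "\<sigma> \<le> s" using that \<tau>_nonneg[of j] by (simp add: \<tau>'_simps)
      from late(2)[OF this] show ?thesis
        using Suc that rest'(8)[of j "s - \<sigma>"] by (simp only: \<tau>'_simps) simp
    qed
    show "?Y (\<tau>' (Suc i)) = - ((-1) ^ i * u\<^sub>0) * \<alpha>" if "i < Suc N" for i
    proof (cases i)
      case 0
      then show ?thesis using phase(3) rest'(4) by (simp add: \<tau>'_simps)
    next
      case (Suc j)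
      then have "\<sigma> \<le> \<tau>' (Suc i)" using that \<tau>_nonneg[of "Suc j"] by (simp add: \<tau>'_simps)
      from late(2)[OF this] show ?thesis
        using Suc that rest'(9)[of j] by (simp only: \<tau>'_simps) simp
    qed
  qed
qed

text \<open>
  Since \<open>\<bar>y'\<bar> \<le> B\<close>, every complete phase takes at least the time
  \<open>2\<alpha> / B\<close>. The induction is on the number of such time units that cover the interval.
\<close>
lemma hysteretic_solution_exists:
  fixes f :: "'a::banach \<times> real \<times> real \<Rightarrow> 'a"
  assumes lip: "\<And>u. u \<in> {-1, 1} \<Longrightarrow> \<exists>L. L-lipschitz_on UNIV (\<lambda>(x, y). (f (x, y, u), g (x, y, u)))"
    and B: "B > 0" "\<And>x y u. u \<in> {-1, 1} \<Longrightarrow> \<bar>g (x, y, u)\<bar> \<le> B"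
    and \<alpha>: "\<alpha> > 0" and "T > 0" "u\<^sub>0 \<in> {-1, 1}"
  shows "\<exists>x y. hysteretic_solution f g \<alpha> T u\<^sub>0 x y \<and> x 0 = x\<^sub>0"
proof -
  have "\<exists>x y. hysteretic_solution f g \<alpha> T u\<^sub>0 x y \<and> x 0 = x\<^sub>0"
    if "0 < T" "T \<le> real n * (2 * \<alpha> / B)" "u\<^sub>0 \<in> {-1, 1}" for n T u\<^sub>0 x\<^sub>0
    using that
  proof (induction n arbitrary: T u\<^sub>0 x\<^sub>0)
    case 0
    then show ?case by simp
  next
    case (Suc n)
    obtain L where "L-lipschitz_on UNIV (\<lambda>(x, y). (f (x, y, u\<^sub>0), g (x, y, u\<^sub>0)))"
      using lip[OF Suc.prems(3)] by blast
    then obtain x y where x0: "x 0 = x\<^sub>0" and y0: "y 0 = u\<^sub>0 * \<alpha>"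
      and sol: "solves_with_control f g u\<^sub>0 {0..T} x y"
      by (rule control_system_solution[OF _ less_imp_le[OF Suc.prems(1)]])
    show ?case
    proof (cases "\<exists>s. 0 \<le> s \<and> s < T \<and> y s = - u\<^sub>0 * \<alpha>")
      case False
      then show ?thesis
        using hysteretic_solution_single_phase[OF Suc.prems(1) sol y0] x0
        by (intro exI[of _ x] exI[of _ y]) auto
    next
      case True
      then obtain s where "0 \<le> s" "s < T" "y s = - u\<^sub>0 * \<alpha>" by blast
      then have "s \<in> {0..T}" by simp
      obtain \<sigma> where \<sigma>: "0 \<le> \<sigma>" "\<sigma> \<le> s" "y \<sigma> = - u\<^sub>0 * \<alpha>"
        and first: "\<And>r. 0 \<le> r \<Longrightarrow> r < \<sigma> \<Longrightarrow> y r \<noteq> - u\<^sub>0 * \<alpha>"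
        by (rule first_hitting_time[OF solves_with_control_continuous_on(2)[OF sol]
              \<open>s \<in> {0..T}\<close> \<open>y s = - u\<^sub>0 * \<alpha>\<close>]) (rule that)
      then have "\<sigma> < T" using \<open>s < T\<close> by simp
      have "\<bar>y \<sigma> - y 0\<bar> = 2 * \<alpha>"
        using Suc.prems(3) \<sigma>(3) y0 \<alpha> by auto
      moreover have "norm (y \<sigma> - y 0) \<le> B * norm (\<sigma> - 0)"
      proof (rule field_differentiable_bound)
        show "(y has_field_derivative g (x t, y t, u\<^sub>0)) (at t within {0..T})" if "t \<in> {0..T}" for t
          using sol that by (simp add: solves_with_control_def)
      qed (use B(2) Suc.prems \<sigma> \<open>\<sigma> < T\<close> in auto)
      ultimately have long: "2 * \<alpha> / B \<le> \<sigma>" and "\<sigma> > 0"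
        using \<sigma>(1) \<alpha> B(1) by (auto simp: field_simps less_le)
      have "T - \<sigma> \<le> real n * (2 * \<alpha> / B)"
        using Suc.prems(2) long unfolding of_nat_Suc distrib_right by linarith
      then obtain x' y' where rest: "hysteretic_solution f g \<alpha> (T - \<sigma>) (- u\<^sub>0) x' y'" "x' 0 = x \<sigma>"
        using Suc.IH[of "T - \<sigma>" "- u\<^sub>0" "x \<sigma>"] \<open>\<sigma> < T\<close> Suc.prems(3) by auto
      have "solves_with_control f g u\<^sub>0 {0..\<sigma>} x y"
        using solves_with_control_subset[OF sol] \<open>\<sigma> < T\<close> by auto
      from hysteretic_solution_prepend_phase[OF \<open>\<sigma> > 0\<close> \<open>\<sigma> < T\<close> this y0 \<sigma>(3) first rest]
      show ?thesis using \<open>\<sigma> > 0\<close> x0 by (intro exI conjI) (assumption, simp)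
    qed
  qed
  moreover obtain n where "T \<le> real n * (2 * \<alpha> / B)"
    using real_arch_simple[of "T / (2 * \<alpha> / B)"] \<alpha> B(1) by (auto simp: field_simps)
  ultimately show ?thesis using assms(5,6) by blast
qed

section \<open>Confinement and growth estimates\<close>

text \<open>
  The upper bound is the intermediate value theorem. If \<open>y\<close> were below \<open>-\<alpha>\<close> at
  some time, consider the last earlier time at which it equals \<open>-\<alpha>\<close>: there it has positive
  derivative, so it rises above \<open>-\<alpha>\<close> and has to cross this level once more.
\<close>
lemma confined_until_exit:
  fixes y :: "real \<Rightarrow> real"
  assumes der: "\<And>t. t \<in> {a..b} \<Longrightarrow> (y has_real_derivative D t) (at t within {a..b})"
    and start: "y a = - \<alpha>" and "0 < \<alpha>"
    and inward: "\<And>t. t \<in> {a..b} \<Longrightarrow> y t = - \<alpha> \<Longrightarrow> 0 < D t"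
    and before_exit: "\<And>t. a \<le> t \<Longrightarrow> t < b \<Longrightarrow> y t \<noteq> \<alpha>"
    and t: "t \<in> {a..b}"
  shows "\<bar>y t\<bar> \<le> \<alpha>"
proof -
  have cont: "continuous_on {a..b} y"
    using der by (meson DERIV_continuous_on)
  have "y t \<le> \<alpha>"
  proof (rule ccontr)
    assume "\<not> y t \<le> \<alpha>"
    then obtain s where "a \<le> s" "s \<le> t" "y s = \<alpha>"
      using IVT'[of y a \<alpha> t] start \<open>0 < \<alpha>\<close> t continuous_on_subset[OF cont, of "{a..t}"] by auto
    moreover have "s \<noteq> t" using \<open>\<not> y t \<le> \<alpha>\<close> \<open>y s = \<alpha>\<close> by auto
    ultimately show False using before_exit[of s] t by auto
  qed
  moreover have "- \<alpha> \<le> y t"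
  proof (rule ccontr)
    assume below: "\<not> - \<alpha> \<le> y t"
    have "continuous_on {a..t} y" using t by (intro continuous_on_subset[OF cont]) auto
    from continuous_closed_preimage_constant[OF this, of "- \<alpha>"]
    have "compact {r \<in> {a..t}. y r = - \<alpha>}"
      by (auto simp: compact_eq_bounded_closed intro: bounded_subset[OF bounded_closed_interval])
    moreover have "a \<in> {r \<in> {a..t}. y r = - \<alpha>}" using start t by simp
    ultimately obtain s where s: "a \<le> s" "s \<le> t" "y s = - \<alpha>"
      and last: "\<And>r. a \<le> r \<Longrightarrow> r \<le> t \<Longrightarrow> y r = - \<alpha> \<Longrightarrow> r \<le> s"
      using compact_attains_sup[of "{r \<in> {a..t}. y r = - \<alpha>}"] by auto
    have "s < t" using s below by (cases "s = t") auto
    have "0 < D s" using inward s t by auto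
    with has_real_derivative_pos_inc_right[OF der[of s]] s t
    obtain d where d: "0 < d" "\<And>h. 0 < h \<Longrightarrow> s + h \<in> {a..b} \<Longrightarrow> h < d \<Longrightarrow> y s < y (s + h)"
      by auto
    define r where "r = s + min (d / 2) (t - s)"
    have r: "s < r" "r \<le> t" "y s < y r"
      using d(1) d(2)[of "min (d / 2) (t - s)"] \<open>s < t\<close> s t by (auto simp: r_def min_def split: if_splits)
    have "continuous_on {r..t} y" using t s r by (intro continuous_on_subset[OF cont]) auto
    then obtain q where "r \<le> q" "q \<le> t" "y q = - \<alpha>"
      using IVT2'[of y t "- \<alpha>" r] r s below by auto
    with last[of q] r s show False by auto
  qed
  ultimately show ?thesis by simp
qed

text \<open>
  The squared norm, shifted by \<open>\<alpha>\<^sup>2\<close>, is differentiable even where \<open>e\<close>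
  vanishes and satisfies a homogeneous differential inequality, since
  \<open>2\<bar>e\<bar>\<alpha> \<le> \<bar>e\<bar>\<^sup>2 + \<alpha>\<^sup>2\<close>. In this form
  the estimates on consecutive intervals are chained by transitivity.
\<close>
lemma Gronwall_norm_square:
  fixes e :: "real \<Rightarrow> 'a::real_inner"
  assumes "a \<le> b" "0 \<le> C" "0 \<le> \<alpha>"
    and der: "\<And>t. t \<in> {a..b} \<Longrightarrow> (e has_vector_derivative e' t) (at t within {a..b})"
    and bound: "\<And>t. t \<in> {a..b} \<Longrightarrow> norm (e' t) \<le> C * (norm (e t) + \<alpha>)"
  shows "exp (- (3 * C) * b) * ((norm (e b))\<^sup>2 + \<alpha>\<^sup>2) \<le> exp (- (3 * C) * a) * ((norm (e a))\<^sup>2 + \<alpha>\<^sup>2)"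
proof (rule DERIV_nonpos_imp_decreasing_open[OF \<open>a \<le> b\<close>])
  have "continuous_on {a..b} e" using der by (rule continuous_on_vector_derivative)
  then show "continuous_on {a..b} (\<lambda>t. exp (- (3 * C) * t) * ((norm (e t))\<^sup>2 + \<alpha>\<^sup>2))"
    by (intro continuous_intros)
  fix t assume t: "a < t" "t < b"
  have "(e has_derivative (\<lambda>h. h *\<^sub>R e' t)) (at t)"
    using der[of t] t by (simp add: has_vector_derivative_def at_within_Icc_at)
  from has_derivative_inner[OF this this]
  have "((\<lambda>t. (norm (e t))\<^sup>2) has_real_derivative 2 * (e t \<bullet> e' t)) (at t)"
    unfolding has_field_derivative_def power2_norm_eq_inner
    by (rule has_derivative_eq_rhs) (auto simp: inner_commute)
  note norm_deriv = DERIV_add[OF this DERIV_const[of "\<alpha>\<^sup>2"]]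
  have "((\<lambda>t. exp (- (3 * C) * t)) has_real_derivative exp (- (3 * C) * t) * (- (3 * C))) (at t)"
    by (auto intro!: derivative_eq_intros)
  from DERIV_mult[OF this norm_deriv]
  have "((\<lambda>t. exp (- (3 * C) * t) * ((norm (e t))\<^sup>2 + \<alpha>\<^sup>2)) has_real_derivative
      exp (- (3 * C) * t) * (2 * (e t \<bullet> e' t) - 3 * C * ((norm (e t))\<^sup>2 + \<alpha>\<^sup>2))) (at t)"
    by (rule DERIV_cong) (simp add: algebra_simps)
  moreover have "2 * (e t \<bullet> e' t) \<le> 3 * C * ((norm (e t))\<^sup>2 + \<alpha>\<^sup>2)"
  proof -
    have "e t \<bullet> e' t \<le> norm (e t) * norm (e' t)" by (rule norm_cauchy_schwarz)
    also have "\<dots> \<le> norm (e t) * (C * (norm (e t) + \<alpha>))"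
      using bound[of t] t by (intro mult_left_mono) auto
    finally have "2 * (e t \<bullet> e' t) \<le> C * (2 * (norm (e t))\<^sup>2 + 2 * norm (e t) * \<alpha>)"
      by (simp add: power2_eq_square algebra_simps)
    also have "\<dots> \<le> C * (3 * ((norm (e t))\<^sup>2 + \<alpha>\<^sup>2))"
    proof (rule mult_left_mono[OF _ \<open>0 \<le> C\<close>])
      show "2 * (norm (e t))\<^sup>2 + 2 * norm (e t) * \<alpha> \<le> 3 * ((norm (e t))\<^sup>2 + \<alpha>\<^sup>2)"
        using sum_squares_bound[of "norm (e t)" \<alpha>] zero_le_power2[of \<alpha>]
        unfolding distrib_left mult.assoc by linarith
    qed
    finally show ?thesis by (simp add: algebra_simps)
  qed
  ultimately show "\<exists>D. ((\<lambda>t. exp (- (3 * C) * t) * ((norm (e t))\<^sup>2 + \<alpha>\<^sup>2)) has_real_derivative D) (at t) \<and> D \<le> 0"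
    by (intro exI conjI) (assumption, simp add: mult_le_0_iff)
qed

section \<open>Tracking of the sliding solution\<close>

text \<open>
  The factor \<open>h\<close> by which velocities of \<open>y\<close> produce deviations from the Filippov field.
\<close>
definition jump_ratio ::
  "('a::real_normed_vector \<times> real \<times> real \<Rightarrow> 'a) \<Rightarrow> ('a \<times> real \<times> real \<Rightarrow> real) \<Rightarrow> 'a \<Rightarrow> 'a" where
  "jump_ratio f g x = (f (x, 0, -1) - f (x, 0, 1)) /\<^sub>R (g (x, 0, -1) - g (x, 0, 1))"

text \<open>
  The Filippov field is the point with vanishing \<open>g\<close>-component on the line through
  \<open>(f\<^sup>+, g\<^sup>+)\<close> and \<open>(f\<^sup>-, g\<^sup>-)\<close>, and
  \<open>jump_ratio\<close> is the slope of that line; hence both end points satisfy the same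
  affine relation.
\<close>
lemma filippov_decomposition:
  assumes "g (x, 0, 1) \<noteq> g (x, 0, -1)" "u \<in> {-1, 1}"
  shows "f (x, 0, u) = filippov_field f g x + g (x, 0, u) *\<^sub>R jump_ratio f g x"
proof -
  let ?d = "g (x, 0, -1) - g (x, 0, 1)"
  have "filippov_field f g x + g (x, 0, u) *\<^sub>R jump_ratio f g x = inverse ?d *\<^sub>R (?d *\<^sub>R f (x, 0, u))"
    using assms(2) unfolding filippov_field_def jump_ratio_def
    by (auto simp: scaleR_add_right[symmetric] mult.commute scaleR_scaleR[symmetric] scaleR_left_commute[of "g _"] simp del: scaleR_scaleR)
       (auto simp: algebra_simps)
  then show ?thesis using assms(1) by simp
qed

text \<open>
  The quantitative content of the hypotheses on the cylinder \<open>\<bar>x\<bar> \<le> M,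
  \<bar>y\<bar> \<le> \<eta>\<close>, with a single constant \<open>K\<close> for all bounds.
  The condition on signs says that
  \<open>u y\<close> decreases, so that a phase with control \<open>u\<close> moves from
  \<open>y = u\<alpha>\<close> towards \<open>y = -u\<alpha>\<close>.
\<close>
locale sliding_patch =
  fixes f :: "'a::real_inner \<times> real \<times> real \<Rightarrow> 'a" and g :: "'a \<times> real \<times> real \<Rightarrow> real"
    and M \<eta> K :: real
  assumes inward: "norm x \<le> M \<Longrightarrow> \<bar>y\<bar> \<le> \<eta> \<Longrightarrow> u \<in> {-1, 1} \<Longrightarrow> u * g (x, y, u) < 0"
    and K_pos: "0 < K" and \<eta>_pos: "0 < \<eta>"
    and f_bound: "norm x \<le> M \<Longrightarrow> \<bar>y\<bar> \<le> \<eta> \<Longrightarrow> u \<in> {-1, 1} \<Longrightarrow> norm (f (x, y, u)) \<le> K"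
    and f_lip: "norm x \<le> M \<Longrightarrow> \<bar>y\<bar> \<le> \<eta> \<Longrightarrow> u \<in> {-1, 1} \<Longrightarrow>
      norm (f (x, y, u) - f (x, 0, u)) \<le> K * \<bar>y\<bar>"
    and g_lip: "norm x \<le> M \<Longrightarrow> \<bar>y\<bar> \<le> \<eta> \<Longrightarrow> u \<in> {-1, 1} \<Longrightarrow>
      \<bar>g (x, y, u) - g (x, 0, u)\<bar> \<le> K * \<bar>y\<bar>"
    and filippov_lip: "norm x \<le> M \<Longrightarrow> norm x' \<le> M \<Longrightarrow>
      norm (filippov_field f g x - filippov_field f g x') \<le> K * norm (x - x')"
    and jump_bound: "norm x \<le> M \<Longrightarrow> norm (jump_ratio f g x) \<le> K"
    and jump_deriv: "norm x \<le> M \<Longrightarrow>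
      \<exists>D. (jump_ratio f g has_derivative D) (at x) \<and> (\<forall>v. norm (D v) \<le> K * norm v)"
begin

definition rate :: real where "rate = K + 3 * K\<^sup>2"

text \<open>
  Subtracting \<open>y h(x)\<close> from the difference of the two solutions removes the only part of its
  velocity that is not small, namely the one that oscillates with the control.
\<close>
definition corrected_error :: "(real \<Rightarrow> 'a) \<Rightarrow> (real \<Rightarrow> 'a) \<Rightarrow> (real \<Rightarrow> real) \<Rightarrow> real \<Rightarrow> 'a" where
  "corrected_error x\<^sub>F x y t = x t - y t *\<^sub>R jump_ratio f g (x t) - x\<^sub>F t"

lemma rate_pos: "0 < rate"
  using K_pos by (simp add: rate_def add_pos_pos)

text \<open>
  Writing \<open>v\<close>, \<open>w\<close> for the current velocities of \<open>x\<close> and \<open>y\<close>,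
  the derivative is
  \<open>v - w h(x) - y Dh(x)v - f\<^sub>F(x\<^sub>F)\<close>. By \<open>filippov_decomposition\<close> the
  first two terms are \<open>f\<^sub>F(x)\<close> up to the change of \<open>f\<close> and \<open>g\<close>
  between height \<open>0\<close> and height \<open>y\<close>, which is at most \<open>K\<bar>y\<bar>\<close>.
  The constant \<open>rate\<close> collects the resulting coefficients: \<open>K\<close> for
  \<open>\<bar>e\<bar>\<close>, and \<open>K + 3K\<^sup>2\<close> for \<open>\<alpha>\<close>.
\<close>
lemma corrected_error_derivative:
  assumes u: "u \<in> {-1, 1}" and \<alpha>: "0 < \<alpha>" "\<alpha> \<le> \<eta>"
    and sol: "solves_with_control f g u I x y" and t: "t \<in> I"
    and slide: "(x\<^sub>F has_vector_derivative filippov_field f g (x\<^sub>F t)) (at t within I)"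
    and xy: "norm (x t) \<le> M" "\<bar>y t\<bar> \<le> \<alpha>" and xF: "norm (x\<^sub>F t) \<le> M"
  shows "\<exists>e'. (corrected_error x\<^sub>F x y has_vector_derivative e') (at t within I) \<and>
    norm e' \<le> rate * (norm (corrected_error x\<^sub>F x y t) + \<alpha>)"
proof -
  let ?F = "filippov_field f g" and ?h = "jump_ratio f g (x t)"
  let ?v = "f (x t, y t, u)" and ?w = "g (x t, y t, u)" and ?e = "corrected_error x\<^sub>F x y t"
  have y\<eta>: "\<bar>y t\<bar> \<le> \<eta>" using xy \<alpha> by simp
  have dx: "(x has_vector_derivative ?v) (at t within I)"
    and dy: "(y has_real_derivative ?w) (at t within I)"
    using sol t by (auto simp: solves_with_control_def)
  obtain D where D: "(jump_ratio f g has_derivative D) (at (x t))" "\<And>v. norm (D v) \<le> K * norm v"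
    using jump_deriv[OF xy(1)] by blast
  have lin: "D (s *\<^sub>R v) = s *\<^sub>R D v" for s v
    using has_derivative_linear[OF D(1)] by (simp add: linear_cmul)
  have dh: "((\<lambda>s. jump_ratio f g (x s)) has_vector_derivative D ?v) (at t within I)"
    using has_derivative_compose[OF dx[unfolded has_vector_derivative_def] D(1)]
    by (simp add: has_vector_derivative_def lin)
  define e' where "e' = ?v - (y t *\<^sub>R D ?v + ?w *\<^sub>R ?h) - ?F (x\<^sub>F t)"
  have de: "(corrected_error x\<^sub>F x y has_vector_derivative e') (at t within I)"
    unfolding corrected_error_def[abs_def] e'_def
    by (intro has_vector_derivative_diff has_vector_derivative_scaleR dx dy dh slide)
  have "g (x t, 0, 1) \<noteq> g (x t, 0, -1)"
    using inward[OF xy(1), of 0 1] inward[OF xy(1), of 0 "-1"] \<eta>_pos by auto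
  note decomposition = filippov_decomposition[OF this u, of f]
  have triangle: "norm (p + q - r - s) \<le> norm p + norm q + norm r + norm s" for p q r s :: 'a
    using norm_triangle_ineq4[of "p + q - r" s] norm_triangle_ineq4[of "p + q" r] norm_triangle_ineq[of p q]
    by linarith
  have yh: "norm (y t *\<^sub>R ?h) \<le> \<alpha> * K"
    using mult_mono[OF xy(2) jump_bound[OF xy(1)]] \<alpha> by simp
  have "norm (x t - x\<^sub>F t) = norm (?e + y t *\<^sub>R ?h)"
    by (simp add: corrected_error_def)
  also have "\<dots> \<le> norm ?e + \<alpha> * K"
    by (rule norm_triangle_le) (use yh in simp)
  finally have "K * norm (x t - x\<^sub>F t) \<le> K * (norm ?e + \<alpha> * K)"
    using K_pos by simp
  then have b1: "norm (?F (x t) - ?F (x\<^sub>F t)) \<le> K * (norm ?e + \<alpha> * K)"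
    using filippov_lip[OF xy(1) xF] by simp
  have Ky: "K * \<bar>y t\<bar> \<le> K * \<alpha>" using K_pos xy(2) by simp
  then have b2: "norm (?v - f (x t, 0, u)) \<le> K * \<alpha>"
    using f_lip[OF xy(1) y\<eta> u] by simp
  have "\<bar>?w - g (x t, 0, u)\<bar> \<le> K * \<alpha>"
    using g_lip[OF xy(1) y\<eta> u] Ky by simp
  from mult_mono[OF this jump_bound[OF xy(1)]]
  have b3: "norm ((?w - g (x t, 0, u)) *\<^sub>R ?h) \<le> (K * \<alpha>) * K"
    using K_pos \<alpha> by simp
  have "norm (D ?v) \<le> K * K"
    using order_trans[OF D(2) mult_left_mono[OF f_bound[OF xy(1) y\<eta> u]]] K_pos by simp
  from mult_mono[OF xy(2) this] have b4: "norm (y t *\<^sub>R D ?v) \<le> \<alpha> * (K * K)"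
    using \<alpha> by simp
  from decomposition
  have e'_eq: "e' = (?F (x t) - ?F (x\<^sub>F t)) + (?v - f (x t, 0, u))
      - (?w - g (x t, 0, u)) *\<^sub>R ?h - y t *\<^sub>R D ?v"
    by (simp add: e'_def algebra_simps)
  have "norm e' \<le> norm (?F (x t) - ?F (x\<^sub>F t)) + norm (?v - f (x t, 0, u))
      + norm ((?w - g (x t, 0, u)) *\<^sub>R ?h) + norm (y t *\<^sub>R D ?v)"
    unfolding e'_eq by (rule triangle)
  also have "\<dots> \<le> K * (norm ?e + \<alpha> * K) + K * \<alpha> + (K * \<alpha>) * K + \<alpha> * (K * K)"
    by (intro add_mono b1 b2 b3 b4)
  also have "\<dots> \<le> rate * (norm ?e + \<alpha>)"
    using K_pos by (simp add: rate_def power2_eq_square algebra_simps)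
  finally show ?thesis using de by blast
qed

lemma energy_decay_on_phase:
  assumes u: "u \<in> {-1, 1}" and \<alpha>: "0 < \<alpha>" "\<alpha> \<le> \<eta>" and "a \<le> b"
    and sol: "solves_with_control f g u {a..b} x y"
    and slide: "\<And>t. t \<in> {a..b} \<Longrightarrow> (x\<^sub>F has_vector_derivative filippov_field f g (x\<^sub>F t)) (at t within {a..b})"
    and region: "\<And>t. t \<in> {a..b} \<Longrightarrow> norm (x t) \<le> M \<and> \<bar>y t\<bar> \<le> \<alpha> \<and> norm (x\<^sub>F t) \<le> M"
  shows "exp (- (3 * rate) * b) * ((norm (corrected_error x\<^sub>F x y b))\<^sup>2 + \<alpha>\<^sup>2)
    \<le> exp (- (3 * rate) * a) * ((norm (corrected_error x\<^sub>F x y a))\<^sup>2 + \<alpha>\<^sup>2)"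
proof -
  have "\<exists>e'. (corrected_error x\<^sub>F x y has_vector_derivative e') (at t within {a..b}) \<and>
    norm e' \<le> rate * (norm (corrected_error x\<^sub>F x y t) + \<alpha>)" if "t \<in> {a..b}" for t
    using corrected_error_derivative[OF u \<alpha> sol that slide[OF that]] region[OF that] by blast
  then obtain e' where "\<And>t. t \<in> {a..b} \<Longrightarrow> (corrected_error x\<^sub>F x y has_vector_derivative e' t) (at t within {a..b})"
    "\<And>t. t \<in> {a..b} \<Longrightarrow> norm (e' t) \<le> rate * (norm (corrected_error x\<^sub>F x y t) + \<alpha>)"
    by metis
  then show ?thesis
    by (rule Gronwall_norm_square[OF \<open>a \<le> b\<close> less_imp_le[OF rate_pos] less_imp_le[OF \<alpha>(1)]])
qed

text \<open>
  The second summand bounds the corrected error over \<open>\<alpha>\<close>: it starts at most at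
  \<open>K\<alpha>\<close> and its shifted square grows at most at the rate \<open>3 rate\<close>. The first summand
  accounts for the correction \<open>y h(x)\<close>.
\<close>
definition tracking_constant :: "real \<Rightarrow> real" where
  "tracking_constant T = K + sqrt (exp (3 * rate * T) * (K\<^sup>2 + 1))"

lemma tracking_constant_pos: "0 < tracking_constant T"
  using K_pos by (simp add: tracking_constant_def add_pos_nonneg)

text \<open>
  Here and below the phases solve fields \<open>f'\<close>, \<open>g'\<close> that agree with \<open>f\<close>,
  \<open>g\<close> on the cylinder only. This covers both the given system and its globally Lipschitz
  modification. The two values of the control are treated at once by applying
  \<open>confined_until_exit\<close> to \<open>-u y\<close>, which runs from \<open>-\<alpha>\<close> to
  \<open>\<alpha>\<close>.
\<close>
lemma confined_phase:
  assumes u: "u \<in> {-1, 1}" and \<alpha>: "0 < \<alpha>" "\<alpha> \<le> \<eta>"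
    and sol: "solves_with_control f' g' u {a..b} x y"
    and agree: "\<And>x y. norm x \<le> M \<Longrightarrow> \<bar>y\<bar> \<le> \<eta> \<Longrightarrow>
      f' (x, y, u) = f (x, y, u) \<and> g' (x, y, u) = g (x, y, u)"
    and x: "\<And>t. t \<in> {a..b} \<Longrightarrow> norm (x t) \<le> M"
    and start: "y a = u * \<alpha>" and before_exit: "\<And>t. a \<le> t \<Longrightarrow> t < b \<Longrightarrow> y t \<noteq> - u * \<alpha>"
  shows "\<And>t. t \<in> {a..b} \<Longrightarrow> \<bar>y t\<bar> \<le> \<alpha>" and "solves_with_control f g u {a..b} x y"
proof -
  have conf: "\<bar>- u * y t\<bar> \<le> \<alpha>" if "t \<in> {a..b}" for t
  proof (rule confined_until_exit[where y = "\<lambda>t. - u * y t" and D = "\<lambda>t. - u * g' (x t, y t, u)", OF _ _ \<alpha>(1) _ _ that])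
    show "((\<lambda>t. - u * y t) has_real_derivative - u * g' (x t, y t, u)) (at t within {a..b})" if "t \<in> {a..b}" for t
      using sol that by (intro DERIV_cmult) (auto simp: solves_with_control_def)
    show "- u * y a = - \<alpha>" using start u by auto
    show "- u * y t \<noteq> \<alpha>" if "a \<le> t" "t < b" for t
      using before_exit[OF that] u by auto
    show "0 < - u * g' (x t, y t, u)" if "t \<in> {a..b}" "- u * y t = - \<alpha>" for t
    proof -
      have "\<bar>y t\<bar> \<le> \<eta>" using that(2) u \<alpha> by auto
      then show ?thesis using inward[OF x[OF that(1)] _ u] agree[OF x[OF that(1)]] by simp
    qed
  qed
  then show y: "\<bar>y t\<bar> \<le> \<alpha>" if "t \<in> {a..b}" for t
    using u that by fastforce
  show "solves_with_control f g u {a..b} x y"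
    by (rule solves_with_control_cong[OF refl refl _ _ sol])
      (use agree x y \<alpha> in \<open>force+\<close>)
qed

text \<open>
  Confinement of \<open>y\<close> and decay of the weighted energy \<open>E\<close> are carried along together
  from phase to phase. The energy is continuous across a switch because the correction
  \<open>y h(x)\<close> does not involve the control, so the estimates of the phases compose without loss.
\<close>
lemma tracking_while_confined:
  assumes hyst: "hysteretic_solution f' g' \<alpha> T u\<^sub>0 x y"
    and agree: "\<And>x y u. norm x \<le> M \<Longrightarrow> \<bar>y\<bar> \<le> \<eta> \<Longrightarrow> u \<in> {-1, 1} \<Longrightarrow>
      f' (x, y, u) = f (x, y, u) \<and> g' (x, y, u) = g (x, y, u)"
    and \<alpha>: "0 < \<alpha>" "\<alpha> \<le> \<eta>" and u\<^sub>0: "u\<^sub>0 \<in> {-1, 1}" and x0: "x 0 = x\<^sub>F 0"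
    and slide: "\<And>t. t \<in> {0..T} \<Longrightarrow> (x\<^sub>F has_vector_derivative filippov_field f g (x\<^sub>F t)) (at t within {0..T})"
    and xF: "\<And>t. t \<in> {0..T} \<Longrightarrow> norm (x\<^sub>F t) \<le> M"
    and S: "S \<le> T" and x: "\<And>t. t \<in> {0..S} \<Longrightarrow> norm (x t) \<le> M"
    and t: "t \<in> {0..S}"
  shows "\<bar>y t\<bar> \<le> \<alpha> \<and> norm (x t - x\<^sub>F t) \<le> tracking_constant T * \<alpha>"
proof -
  obtain N \<tau> where y0: "y 0 = u\<^sub>0 * \<alpha>"
    and \<tau>: "\<tau> 0 = 0" "\<tau> (Suc N) = T" "\<And>i. i \<le> N \<Longrightarrow> \<tau> i < \<tau> (Suc i)"
    and sol: "\<And>i. i \<le> N \<Longrightarrow> solves_with_control f' g' ((-1) ^ i * u\<^sub>0) {\<tau> i..\<tau> (Suc i)} x y"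
    and before_exit: "\<And>i s. i \<le> N \<Longrightarrow> \<tau> i \<le> s \<Longrightarrow> s < \<tau> (Suc i) \<Longrightarrow> y s \<noteq> - ((-1) ^ i * u\<^sub>0) * \<alpha>"
    and exit: "\<And>i. i < N \<Longrightarrow> y (\<tau> (Suc i)) = - ((-1) ^ i * u\<^sub>0) * \<alpha>"
    and \<tau>_bounds: "\<And>i. i \<le> N \<Longrightarrow> 0 \<le> \<tau> i" "\<And>i. i \<le> N \<Longrightarrow> \<tau> (Suc i) \<le> T"
    by (rule hysteretic_solutionE[OF hyst]) (rule that)
  define E where "E t = exp (- (3 * rate) * t) * ((norm (corrected_error x\<^sub>F x y t))\<^sup>2 + \<alpha>\<^sup>2)" for t
  have "0 \<in> {0..T}" "0 \<in> {0..S}" using t S by auto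
  have "norm (corrected_error x\<^sub>F x y 0) = \<alpha> * norm (jump_ratio f g (x 0))"
    using u\<^sub>0 \<alpha> by (auto simp: corrected_error_def x0 y0)
  also have "\<dots> \<le> \<alpha> * K"
    using \<alpha> jump_bound[OF x[OF \<open>0 \<in> {0..S}\<close>]] by (intro mult_left_mono) auto
  finally have "(norm (corrected_error x\<^sub>F x y 0))\<^sup>2 \<le> (\<alpha> * K)\<^sup>2"
    by (intro power_mono) auto
  then have E0: "E 0 \<le> (K\<^sup>2 + 1) * \<alpha>\<^sup>2"
    by (simp add: E_def power_mult_distrib algebra_simps)
  have phases: "\<forall>t\<in>{0..\<tau> i}. t \<le> S \<longrightarrow> \<bar>y t\<bar> \<le> \<alpha> \<and> E t \<le> (K\<^sup>2 + 1) * \<alpha>\<^sup>2"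
    if "i \<le> Suc N" for i
    using that
  proof (induction i)
    case 0
    have "\<bar>y 0\<bar> = \<alpha>" using y0 u\<^sub>0 \<alpha> by auto
    then show ?case using \<tau>(1) E0 by auto
  next
    case (Suc i)
    then have i: "i \<le> N"
      and IH: "\<And>t. t \<in> {0..\<tau> i} \<Longrightarrow> t \<le> S \<Longrightarrow> \<bar>y t\<bar> \<le> \<alpha> \<and> E t \<le> (K\<^sup>2 + 1) * \<alpha>\<^sup>2" by auto
    note \<tau>i = \<tau>_bounds(1)[OF i]
    define u where "u = (-1) ^ i * u\<^sub>0"
    have u: "u \<in> {-1, 1}" using u\<^sub>0 by (cases "even i") (auto simp: u_def)
    have start: "y (\<tau> i) = u * \<alpha>"
      using y0 \<tau>(1) exit[of "i - 1"] i by (cases i) (auto simp: u_def)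
    have new: "\<bar>y t\<bar> \<le> \<alpha> \<and> E t \<le> (K\<^sup>2 + 1) * \<alpha>\<^sup>2" if t: "\<tau> i < t" "t \<le> \<tau> (Suc i)" "t \<le> S" for t
    proof -
      have sub: "{\<tau> i..t} \<subseteq> {\<tau> i..\<tau> (Suc i)}" "{\<tau> i..t} \<subseteq> {0..T}" "{\<tau> i..t} \<subseteq> {0..S}"
        using t \<tau>i S by auto
      have sol': "solves_with_control f' g' u {\<tau> i..t} x y"
        using solves_with_control_subset[OF sol[OF i] sub(1)] by (simp add: u_def)
      have exit': "y s \<noteq> - u * \<alpha>" if "\<tau> i \<le> s" "s < t" for s
        using before_exit[OF i that(1)] that t by (simp add: u_def)
      have x': "norm (x s) \<le> M" if "s \<in> {\<tau> i..t}" for s using x sub(3) that by blast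
      note conf = confined_phase[OF u \<alpha> sol' agree[OF _ _ u] x' start exit']
      have "E t \<le> E (\<tau> i)"
        unfolding E_def
      proof (rule energy_decay_on_phase[OF u \<alpha> _ conf(2)])
        show "(x\<^sub>F has_vector_derivative filippov_field f g (x\<^sub>F s)) (at s within {\<tau> i..t})"
          if "s \<in> {\<tau> i..t}" for s
          using has_vector_derivative_within_subset[OF slide sub(2)] that sub(2) by blast
      qed (use t x' conf(1) xF sub(2) in auto)
      also have "\<dots> \<le> (K\<^sup>2 + 1) * \<alpha>\<^sup>2" using IH[of "\<tau> i"] \<tau>i t by simp
      finally show ?thesis using conf(1) t by simp
    qed
    have "\<bar>y t\<bar> \<le> \<alpha> \<and> E t \<le> (K\<^sup>2 + 1) * \<alpha>\<^sup>2" if "t \<in> {0..\<tau> (Suc i)}" "t \<le> S" for t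
      using IH[of t] new[of t] that by (cases "t \<le> \<tau> i") simp_all
    then show ?case by blast
  qed
  have yt: "\<bar>y t\<bar> \<le> \<alpha>" and Et: "E t \<le> (K\<^sup>2 + 1) * \<alpha>\<^sup>2"
    using phases[of "Suc N"] \<tau>(2) t S by auto
  let ?e = "corrected_error x\<^sub>F x y t"
  have "(norm ?e)\<^sup>2 \<le> exp (3 * rate * t) * E t"
    by (simp add: E_def exp_minus field_simps)
  also have "\<dots> \<le> exp (3 * rate * T) * ((K\<^sup>2 + 1) * \<alpha>\<^sup>2)"
    using rate_pos t S Et by (intro mult_mono) (auto simp: E_def)
  finally have "norm ?e \<le> sqrt (exp (3 * rate * T) * ((K\<^sup>2 + 1) * \<alpha>\<^sup>2))"
    by (rule real_le_rsqrt)
  also have "\<dots> = sqrt (exp (3 * rate * T) * (K\<^sup>2 + 1)) * \<alpha>"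
    using \<alpha> by (simp add: real_sqrt_mult)
  finally have e: "norm ?e \<le> sqrt (exp (3 * rate * T) * (K\<^sup>2 + 1)) * \<alpha>" .
  have "norm (y t *\<^sub>R jump_ratio f g (x t)) \<le> \<alpha> * K"
    using mult_mono[OF yt jump_bound[OF x[OF t]]] \<alpha> by simp
  with e have "norm (?e + y t *\<^sub>R jump_ratio f g (x t)) \<le> tracking_constant T * \<alpha>"
    by (intro norm_triangle_le) (simp add: tracking_constant_def algebra_simps)
  then show ?thesis using yt by (simp add: corrected_error_def)
qed

text \<open>
  Bootstrapping: up to the first time at which \<open>x\<close> reaches the sphere of radius \<open>M\<close> the
  estimate holds, and it then keeps \<open>x\<close> strictly inside that sphere.
\<close>
lemma tracking:
  assumes hyst: "hysteretic_solution f' g' \<alpha> T u\<^sub>0 x y"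
    and agree: "\<And>x y u. norm x \<le> M \<Longrightarrow> \<bar>y\<bar> \<le> \<eta> \<Longrightarrow> u \<in> {-1, 1} \<Longrightarrow>
      f' (x, y, u) = f (x, y, u) \<and> g' (x, y, u) = g (x, y, u)"
    and \<alpha>: "0 < \<alpha>" "\<alpha> \<le> \<eta>" and u\<^sub>0: "u\<^sub>0 \<in> {-1, 1}" and x0: "x 0 = x\<^sub>F 0"
    and slide: "\<And>t. t \<in> {0..T} \<Longrightarrow> (x\<^sub>F has_vector_derivative filippov_field f g (x\<^sub>F t)) (at t within {0..T})"
    and margin: "\<And>t. t \<in> {0..T} \<Longrightarrow> norm (x\<^sub>F t) + tracking_constant T * \<alpha> < M"
    and t: "t \<in> {0..T}"
  shows "norm (x t) \<le> M \<and> \<bar>y t\<bar> \<le> \<alpha> \<and> norm (x t - x\<^sub>F t) \<le> tracking_constant T * \<alpha>"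
proof -
  have L: "0 < tracking_constant T * \<alpha>" using tracking_constant_pos \<alpha> by simp
  then have xF: "norm (x\<^sub>F t) < M" if "t \<in> {0..T}" for t using margin[OF that] by linarith
  have track: "\<bar>y r\<bar> \<le> \<alpha> \<and> norm (x r - x\<^sub>F r) \<le> tracking_constant T * \<alpha>"
    if "S \<le> T" "\<And>t. t \<in> {0..S} \<Longrightarrow> norm (x t) \<le> M" "r \<in> {0..S}" for S r
    by (rule tracking_while_confined[OF hyst agree \<alpha> u\<^sub>0 x0 slide less_imp_le[OF xF] that])
  have cont: "continuous_on {0..T} (\<lambda>t. norm (x t))"
    using hyst by (auto simp: hysteretic_solution_def intro: continuous_on_norm)
  have inside: "norm (x t) \<le> M" if t: "t \<in> {0..T}" for t
  proof (rule ccontr)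
    assume "\<not> norm (x t) \<le> M"
    moreover have "norm (x 0) < M" using xF[of 0] t x0 by simp
    ultimately obtain s where s: "0 \<le> s" "s \<le> t" "norm (x s) = M"
      using IVT'[of "\<lambda>t. norm (x t)" 0 M t] t continuous_on_subset[OF cont, of "{0..t}"] by auto
    then have "s \<in> {0..T}" using t by auto
    obtain \<sigma> where \<sigma>: "0 \<le> \<sigma>" "\<sigma> \<le> s" "norm (x \<sigma>) = M"
      and first: "\<And>r. 0 \<le> r \<Longrightarrow> r < \<sigma> \<Longrightarrow> norm (x r) \<noteq> M"
      by (rule first_hitting_time[OF cont \<open>s \<in> {0..T}\<close> s(3)]) (rule that)
    have "\<sigma> \<le> T" using \<sigma> \<open>s \<in> {0..T}\<close> by simp
    have "norm (x r) \<le> M" if r: "r \<in> {0..\<sigma>}" for r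
    proof (rule ccontr)
      assume "\<not> norm (x r) \<le> M"
      with IVT'[of "\<lambda>t. norm (x t)" 0 M r] \<open>norm (x 0) < M\<close> r \<open>\<sigma> \<le> T\<close>
        continuous_on_subset[OF cont, of "{0..r}"]
      obtain q where "0 \<le> q" "q \<le> r" "norm (x q) = M" by auto
      moreover have "q \<noteq> r" using calculation \<open>\<not> norm (x r) \<le> M\<close> by auto
      ultimately show False using first[of q] r by auto
    qed
    then have "norm (x \<sigma> - x\<^sub>F \<sigma>) \<le> tracking_constant T * \<alpha>"
      using track[of \<sigma> \<sigma>] \<sigma>(1) \<open>\<sigma> \<le> T\<close> by auto
    moreover have "norm (x\<^sub>F \<sigma>) + tracking_constant T * \<alpha> < M"
      using margin \<sigma>(1) \<open>\<sigma> \<le> T\<close> by simp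
    ultimately show False
      using \<sigma>(3) norm_triangle_sub[of "x \<sigma>" "x\<^sub>F \<sigma>"] by linarith
  qed
  show ?thesis using track[of T t] inside t by blast
qed

end

section \<open>Bounds from smoothness\<close>

text \<open>
  Uniform bounds on values and derivatives are inherited by sums, products and quotients with denominators
  away from zero, which transfers them from \<open>f\<close> and \<open>g\<close> to the Filippov
  field and to \<open>jump_ratio\<close>.
\<close>
definition bounded_deriv_on :: "'a::real_normed_vector set \<Rightarrow> ('a \<Rightarrow> 'b::real_normed_vector) \<Rightarrow> bool" where
  "bounded_deriv_on S h \<longleftrightarrow> (\<exists>K>0. \<forall>p\<in>S. norm (h p) \<le> K \<and>
     (\<exists>D. (h has_derivative D) (at p) \<and> (\<forall>v. norm (D v) \<le> K * norm v)))"

text \<open>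
  Only directional derivatives are known to be continuous; their sum over a basis bounds the operator norm.
\<close>
lemma smooth_imp_bounded_deriv_on:
  fixes h :: "'a::euclidean_space \<Rightarrow> 'b::real_normed_vector"
  assumes "smooth h" "compact S"
  shows "bounded_deriv_on S h"
proof -
  define D where "D p v = frechet_derivative h (at p) v" for p v
  have "cont_diff (Suc 0) h" using assms by (auto simp: smooth_def)
  then have diff: "\<And>p. (h has_derivative D p) (at p)" and D_cont: "\<And>v. continuous_on UNIV (\<lambda>p. D p v)"
    by (auto simp: frechet_derivative_works D_def[abs_def])
  have "continuous_on UNIV h"
    using diff by (meson has_derivative_continuous continuous_at_imp_continuous_on)
  then have "continuous_on S (\<lambda>p. norm (h p) + (\<Sum>b\<in>Basis. norm (D p b)))"
    by (intro continuous_intros) (auto intro: continuous_on_subset D_cont)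
  then have "bounded ((\<lambda>p. norm (h p) + (\<Sum>b\<in>Basis. norm (D p b))) ` S)"
    using compact_continuous_image[OF _ \<open>compact S\<close>] compact_imp_bounded by blast
  then obtain K where "K > 0" and "\<forall>q\<in>(\<lambda>p. norm (h p) + (\<Sum>b\<in>Basis. norm (D p b))) ` S. norm q \<le> K"
    using bounded_pos by metis
  then have K: "norm (h p) + (\<Sum>b\<in>Basis. norm (D p b)) \<le> K" if "p \<in> S" for p
    using that by fastforce
  have "norm (h p) \<le> K \<and> (\<exists>D. (h has_derivative D) (at p) \<and> (\<forall>v. norm (D v) \<le> K * norm v))" if p: "p \<in> S" for p
  proof (intro conjI exI allI)
    show "norm (h p) \<le> K"
      using K[OF p] sum_nonneg[of Basis "\<lambda>b. norm (D p b)"] by simp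
    show "(h has_derivative D p) (at p)" by (rule diff)
    fix v
    interpret linear "D p" using diff has_derivative_linear by blast
    have "norm (D p v) = norm (\<Sum>b\<in>Basis. (v \<bullet> b) *\<^sub>R D p b)"
      by (subst (1) euclidean_representation[of v, symmetric]) (simp add: sum scale)
    also have "\<dots> \<le> (\<Sum>b\<in>Basis. norm (D p b) * norm v)"
      by (rule sum_norm_le) (use Basis_le_norm[of _ v] in \<open>auto simp: mult.commute intro!: mult_right_mono\<close>)
    also have "\<dots> = (\<Sum>b\<in>Basis. norm (D p b)) * norm v"
      by (simp add: sum_distrib_right)
    also have "\<dots> \<le> K * norm v"
      using K[OF p] norm_ge_zero[of "h p"] by (intro mult_right_mono norm_ge_zero) linarith
    finally show "norm (D p v) \<le> K * norm v" .
  qed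
  with \<open>K > 0\<close> show ?thesis
    unfolding bounded_deriv_on_def by blast
qed

lemma bounded_deriv_on_lipschitz:
  assumes "bounded_deriv_on S h" "convex S"
  shows "\<exists>L. L-lipschitz_on S h"
proof -
  obtain K D where K: "K > 0" and D: "\<And>p. p \<in> S \<Longrightarrow> (h has_derivative D p) (at p)"
    "\<And>p v. p \<in> S \<Longrightarrow> norm (D p v) \<le> K * norm v"
    using assms(1) unfolding bounded_deriv_on_def by metis
  have "norm (h p - h q) \<le> K * norm (p - q)" if "p \<in> S" "q \<in> S" for p q
    by (rule differentiable_bound[OF \<open>convex S\<close> has_derivative_at_withinI[OF D(1)]])
       (use that K in \<open>auto intro!: onorm_bound D(2)\<close>)
  then show ?thesis using K by (auto simp: lipschitz_on_def dist_norm intro!: exI[of _ K])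
qed

lemma bounded_deriv_on_add:
  assumes "bounded_deriv_on S p" "bounded_deriv_on S q"
  shows "bounded_deriv_on S (\<lambda>x. p x + q x)"
proof -
  obtain K D where K: "K > 0" "\<And>x. x \<in> S \<Longrightarrow> norm (p x) \<le> K"
    and D: "\<And>x. x \<in> S \<Longrightarrow> (p has_derivative D x) (at x)" "\<And>x v. x \<in> S \<Longrightarrow> norm (D x v) \<le> K * norm v"
    using assms(1) unfolding bounded_deriv_on_def by metis
  obtain J E where J: "J > 0" "\<And>x. x \<in> S \<Longrightarrow> norm (q x) \<le> J"
    and E: "\<And>x. x \<in> S \<Longrightarrow> (q has_derivative E x) (at x)" "\<And>x v. x \<in> S \<Longrightarrow> norm (E x v) \<le> J * norm v"
    using assms(2) unfolding bounded_deriv_on_def by metis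
  show ?thesis unfolding bounded_deriv_on_def
  proof (intro exI[of _ "K + J"] conjI ballI)
    fix x assume x: "x \<in> S"
    show "norm (p x + q x) \<le> K + J"
      using K(2)[OF x] J(2)[OF x] norm_triangle_mono by blast
    show "\<exists>D. ((\<lambda>x. p x + q x) has_derivative D) (at x) \<and> (\<forall>v. norm (D v) \<le> (K + J) * norm v)"
      by (intro exI[of _ "\<lambda>v. D x v + E x v"] conjI allI has_derivative_add D E x)
        (use norm_triangle_mono[OF D(2)[OF x] E(2)[OF x]] in \<open>simp add: algebra_simps\<close>)
  qed (use K J in simp)
qed

lemma bounded_deriv_on_scaleR:
  fixes p :: "'a::real_normed_vector \<Rightarrow> real"
  assumes "bounded_deriv_on S p" "bounded_deriv_on S q"
  shows "bounded_deriv_on S (\<lambda>x. p x *\<^sub>R q x)"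
proof -
  obtain K D where K: "K > 0" "\<And>x. x \<in> S \<Longrightarrow> norm (p x) \<le> K"
    and D: "\<And>x. x \<in> S \<Longrightarrow> (p has_derivative D x) (at x)" "\<And>x v. x \<in> S \<Longrightarrow> norm (D x v) \<le> K * norm v"
    using assms(1) unfolding bounded_deriv_on_def by metis
  obtain J E where J: "J > 0" "\<And>x. x \<in> S \<Longrightarrow> norm (q x) \<le> J"
    and E: "\<And>x. x \<in> S \<Longrightarrow> (q has_derivative E x) (at x)" "\<And>x v. x \<in> S \<Longrightarrow> norm (E x v) \<le> J * norm v"
    using assms(2) unfolding bounded_deriv_on_def by metis
  show ?thesis unfolding bounded_deriv_on_def
  proof (intro exI[of _ "2 * K * J"] conjI ballI)
    fix x assume x: "x \<in> S"
    have "norm (p x *\<^sub>R q x) \<le> K * J"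
      using mult_mono[OF K(2)[OF x] J(2)[OF x]] K(1) by simp
    also have "\<dots> \<le> 2 * K * J" using K J by simp
    finally show "norm (p x *\<^sub>R q x) \<le> 2 * K * J" .
    have "norm (p x *\<^sub>R E x v + D x v *\<^sub>R q x) \<le> 2 * K * J * norm v" for v
    proof -
      have "norm (p x *\<^sub>R E x v) \<le> K * (J * norm v)"
        using mult_mono[OF K(2)[OF x] E(2)[OF x, of v]] K(1) by simp
      moreover have "norm (D x v *\<^sub>R q x) \<le> (K * norm v) * J"
        using mult_mono[OF D(2)[OF x, of v] J(2)[OF x]] K(1) by simp
      ultimately show ?thesis
        using norm_triangle_mono[of "p x *\<^sub>R E x v" "K * (J * norm v)" "D x v *\<^sub>R q x" "K * norm v * J"]
        by (simp add: algebra_simps)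
    qed
    then show "\<exists>D. ((\<lambda>x. p x *\<^sub>R q x) has_derivative D) (at x) \<and> (\<forall>v. norm (D v) \<le> 2 * K * J * norm v)"
      using has_derivative_scaleR[OF D(1)[OF x] E(1)[OF x]] by blast
  qed (use K J in simp)
qed

lemma bounded_deriv_on_inverse:
  fixes p :: "'a::real_normed_vector \<Rightarrow> real"
  assumes "bounded_deriv_on S p" and c: "c > 0" "\<And>x. x \<in> S \<Longrightarrow> c \<le> p x"
  shows "bounded_deriv_on S (\<lambda>x. inverse (p x))"
proof -
  obtain K D where K: "K > 0" "\<And>x. x \<in> S \<Longrightarrow> norm (p x) \<le> K"
    and D: "\<And>x. x \<in> S \<Longrightarrow> (p has_derivative D x) (at x)" "\<And>x v. x \<in> S \<Longrightarrow> norm (D x v) \<le> K * norm v"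
    using assms(1) unfolding bounded_deriv_on_def by metis
  define i where "i = inverse c"
  have i0: "0 < i" using c by (simp add: i_def)
  show ?thesis unfolding bounded_deriv_on_def
  proof (intro exI[of _ "i + i * K * i"] conjI ballI)
    fix x assume x: "x \<in> S"
    have px: "0 < p x" using c(1) c(2)[OF x] by simp
    have inv: "norm (inverse (p x)) \<le> i"
      using px c(1) c(2)[OF x] by (simp add: i_def le_imp_inverse_le)
    then show "norm (inverse (p x)) \<le> i + i * K * i"
      using K i0 by (smt (verit) mult_pos_pos)
    have "norm (- (inverse (p x) * D x v * inverse (p x))) \<le> (i + i * K * i) * norm v" for v
    proof -
      have "norm (- (inverse (p x) * D x v * inverse (p x)))
          = norm (inverse (p x)) * norm (D x v) * norm (inverse (p x))"
        by (simp only: norm_minus_cancel norm_mult)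
      also have "\<dots> \<le> i * (K * norm v) * i"
        using i0 K(1) by (intro mult_mono inv D(2) x) auto
      also have "\<dots> \<le> (i + i * K * i) * norm v"
        using i0 by (simp add: algebra_simps)
      finally show ?thesis .
    qed
    then show "\<exists>D. ((\<lambda>x. inverse (p x)) has_derivative D) (at x) \<and> (\<forall>v. norm (D v) \<le> (i + i * K * i) * norm v)"
      using Deriv.has_derivative_inverse[OF _ D(1)[OF x]] px by (intro exI[of _ "\<lambda>v. - (inverse (p x) * D x v * inverse (p x))"]) simp
  qed (use K i0 in \<open>smt (verit) mult_pos_pos\<close>)
qed

lemma bounded_deriv_on_slice:
  fixes h :: "'a::real_normed_vector \<times> real \<times> real \<Rightarrow> 'b::real_normed_vector"
  assumes "bounded_deriv_on Q h" "\<And>x. x \<in> S \<Longrightarrow> (x, 0, u) \<in> Q"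
  shows "bounded_deriv_on S (\<lambda>x. h (x, 0, u))"
proof -
  obtain K D where K: "K > 0" "\<And>p. p \<in> Q \<Longrightarrow> norm (h p) \<le> K"
    and D: "\<And>p. p \<in> Q \<Longrightarrow> (h has_derivative D p) (at p)" "\<And>p v. p \<in> Q \<Longrightarrow> norm (D p v) \<le> K * norm v"
    using assms(1) unfolding bounded_deriv_on_def by metis
  have "((\<lambda>x. (x, 0, u)) has_derivative (\<lambda>v. (v, 0, 0))) (at x)" for x :: 'a
    by (auto intro!: derivative_eq_intros simp: zero_prod_def)
  then have "((\<lambda>x. h (x, 0, u)) has_derivative (\<lambda>v. D (x, 0, u) (v, 0, 0))) (at x)" if "x \<in> S" for x
    using has_derivative_compose D(1) assms(2) that by blast
  moreover have "norm (D (x, 0, u) (v, 0, 0)) \<le> K * norm v" if "x \<in> S" for x v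
    using D(2)[OF assms(2)[OF that], of "(v, 0, 0)"] by (simp add: norm_Pair)
  ultimately show ?thesis
    unfolding bounded_deriv_on_def using K assms(2) by blast
qed

lemma bounded_deriv_on_const: "bounded_deriv_on S (\<lambda>_. c)"
  unfolding bounded_deriv_on_def
proof (intro exI[of _ "norm c + 1"] conjI ballI)
  show "0 < norm c + 1" by (simp add: add_nonneg_pos)
  show "\<exists>D. ((\<lambda>_. c) has_derivative D) (at p) \<and> (\<forall>v. norm (D v) \<le> (norm c + 1) * norm v)" for p
    by (intro exI[of _ "\<lambda>_. 0"]) simp
qed simp

lemma bounded_deriv_on_diff:
  assumes "bounded_deriv_on S p" "bounded_deriv_on S q"
  shows "bounded_deriv_on S (\<lambda>x. p x - q x)"
  using bounded_deriv_on_add[OF assms(1) bounded_deriv_on_scaleR[OF bounded_deriv_on_const assms(2), of "-1"]] by simp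

lemma bounded_deriv_on_imp_continuous_on:
  assumes "bounded_deriv_on S p"
  shows "continuous_on S p"
  using assms unfolding bounded_deriv_on_def
  by (meson continuous_at_imp_continuous_on has_derivative_continuous)

text \<open>
  On the compact ball the sign condition holds at \<open>y = 0\<close> with a margin \<open>c\<close>, and the
  Lipschitz bound of \<open>g\<close> preserves it up to a height \<open>\<eta>\<close> proportional to
  \<open>c\<close>. The same margin keeps the denominators of \<open>jump_ratio\<close> and
  \<open>filippov_field\<close> away from \<open>0\<close>.
\<close>
lemma sliding_patch_exists:
  fixes f :: "'a::euclidean_space \<times> real \<times> real \<Rightarrow> 'a"
  assumes "smooth f" "smooth g" "0 < M"
    and sign: "\<And>x. norm x \<le> M \<Longrightarrow> g (x, 0, 1) < 0 \<and> 0 < g (x, 0, -1)"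
  obtains \<eta> K where "sliding_patch f g M \<eta> K"
proof -
  define S where "S = (cball 0 M :: 'a set)"
  define Q where "Q = S \<times> cball (0::real) 1 \<times> cball (0::real) 1"
  have Q: "compact Q" "convex Q"
    unfolding Q_def S_def by (intro compact_Times convex_Times compact_cball convex_cball)+
  have S: "compact S" "convex S" "S \<noteq> {}" using \<open>0 < M\<close> by (auto simp: S_def)
  have mem_Q: "(x, y, u) \<in> Q" if "norm x \<le> M" "\<bar>y\<bar> \<le> 1" "u \<in> {-1, 1}" for x y u
    using that by (auto simp: Q_def S_def)
  have fC: "bounded_deriv_on Q f" and gC: "bounded_deriv_on Q g"
    using assms(1,2) Q(1) by (auto intro: smooth_imp_bounded_deriv_on)
  have slice: "bounded_deriv_on S (\<lambda>x. f (x, 0, u))" "bounded_deriv_on S (\<lambda>x. g (x, 0, u))" if "u \<in> {-1, 1}" for u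
    using that by (auto intro!: bounded_deriv_on_slice[OF fC] bounded_deriv_on_slice[OF gC] mem_Q simp: S_def)
  have "continuous_on S (\<lambda>x. min (g (x, 0, -1)) (- g (x, 0, 1)))"
    by (intro continuous_on_min continuous_on_minus bounded_deriv_on_imp_continuous_on slice) auto
  then obtain x\<^sub>m where xm: "x\<^sub>m \<in> S" and least:
    "\<And>x. x \<in> S \<Longrightarrow> min (g (x\<^sub>m, 0, -1)) (- g (x\<^sub>m, 0, 1)) \<le> min (g (x, 0, -1)) (- g (x, 0, 1))"
    using continuous_attains_inf[OF S(1,3)] by blast
  define c where "c = min (g (x\<^sub>m, 0, -1)) (- g (x\<^sub>m, 0, 1))"
  have "0 < c" using sign[of x\<^sub>m] xm by (simp add: c_def S_def)
  have c: "c \<le> g (x, 0, -1)" "g (x, 0, 1) \<le> - c" if "x \<in> S" for x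
    using least[OF that] by (auto simp: c_def)
  have inv: "bounded_deriv_on S (\<lambda>x. inverse (g (x, 0, -1) - g (x, 0, 1)))"
  proof (rule bounded_deriv_on_inverse[OF bounded_deriv_on_diff])
    show "c \<le> g (x, 0, -1) - g (x, 0, 1)" if "x \<in> S" for x using c[OF that] \<open>0 < c\<close> by linarith
  qed (use slice \<open>0 < c\<close> in auto)
  have jumpC: "bounded_deriv_on S (jump_ratio f g)"
    unfolding jump_ratio_def[abs_def]
    by (intro bounded_deriv_on_scaleR bounded_deriv_on_diff inv slice) auto
  have filC: "bounded_deriv_on S (filippov_field f g)"
    unfolding filippov_field_def[abs_def]
    by (intro bounded_deriv_on_scaleR bounded_deriv_on_diff inv slice) auto
  obtain K\<^sub>f where Kf: "0 < K\<^sub>f" "\<And>p. p \<in> Q \<Longrightarrow> norm (f p) \<le> K\<^sub>f"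
    using fC unfolding bounded_deriv_on_def by blast
  obtain K\<^sub>j where Kj: "0 < K\<^sub>j" "\<And>x. x \<in> S \<Longrightarrow> norm (jump_ratio f g x) \<le> K\<^sub>j"
      "\<And>x. x \<in> S \<Longrightarrow> \<exists>D. (jump_ratio f g has_derivative D) (at x) \<and> (\<forall>v. norm (D v) \<le> K\<^sub>j * norm v)"
    using jumpC unfolding bounded_deriv_on_def by blast
  obtain L\<^sub>f L\<^sub>g L\<^sub>F where L: "L\<^sub>f-lipschitz_on Q f" "L\<^sub>g-lipschitz_on Q g" "L\<^sub>F-lipschitz_on S (filippov_field f g)"
    using bounded_deriv_on_lipschitz fC gC filC Q(2) S(2) by metis
  note L_nonneg = L[THEN lipschitz_on_nonneg]
  define \<eta> where "\<eta> = min 1 (c / (2 * (L\<^sub>g + 1)))"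
  have \<eta>: "0 < \<eta>" "\<eta> \<le> 1" using \<open>0 < c\<close> L_nonneg by (auto simp: \<eta>_def)
  have "L\<^sub>g * \<eta> < c"
  proof -
    have "(2 * (L\<^sub>g + 1)) * \<eta> \<le> (2 * (L\<^sub>g + 1)) * (c / (2 * (L\<^sub>g + 1)))"
      using L_nonneg by (intro mult_left_mono) (auto simp: \<eta>_def)
    also have "\<dots> = c" using L_nonneg by simp
    finally have "2 * (L\<^sub>g * \<eta>) + 2 * \<eta> \<le> c" by (simp add: algebra_simps)
    moreover have "0 \<le> L\<^sub>g * \<eta>" using L_nonneg \<eta>(1) by simp
    ultimately show ?thesis using \<eta>(1) by linarith
  qed
  define K where "K = K\<^sub>f + K\<^sub>j + L\<^sub>f + L\<^sub>g + L\<^sub>F"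
  have K: "K\<^sub>f \<le> K" "K\<^sub>j \<le> K" "L\<^sub>f \<le> K" "L\<^sub>g \<le> K" "L\<^sub>F \<le> K" "0 < K"
    using Kf(1) Kj(1) L_nonneg by (auto simp: K_def)
  have vertical: "dist (x, y, u) (x, 0, u) = \<bar>y\<bar>" for x :: 'a and y u :: real
    by (simp add: dist_Pair_Pair dist_real_def)
  have g_near: "\<bar>g (x, y, u) - g (x, 0, u)\<bar> \<le> L\<^sub>g * \<bar>y\<bar>"
    and f_near: "norm (f (x, y, u) - f (x, 0, u)) \<le> L\<^sub>f * \<bar>y\<bar>"
    if "norm x \<le> M" "\<bar>y\<bar> \<le> \<eta>" "u \<in> {-1, 1}" for x y u
    using lipschitz_onD[OF L(2), of "(x, y, u)" "(x, 0, u)"] lipschitz_onD[OF L(1), of "(x, y, u)" "(x, 0, u)"]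
      mem_Q[of x y u] mem_Q[of x 0 u] that \<eta>(2)
    by (auto simp: vertical dist_norm[symmetric] dist_real_def)
  have "sliding_patch f g M \<eta> K"
  proof
    fix x :: 'a and y u :: real
    assume xyu: "norm x \<le> M" "\<bar>y\<bar> \<le> \<eta>" "u \<in> {-1, 1}"
    then have xQ: "(x, y, u) \<in> Q" using mem_Q \<eta> by simp
    have "L\<^sub>g * \<bar>y\<bar> \<le> L\<^sub>g * \<eta>" using xyu L_nonneg by (intro mult_left_mono) auto
    with g_near[OF xyu] \<open>L\<^sub>g * \<eta> < c\<close> have "\<bar>g (x, y, u) - g (x, 0, u)\<bar> < c" by linarith
    then show "u * g (x, y, u) < 0" using c[of x] xyu by (auto simp: S_def)
    show "norm (f (x, y, u)) \<le> K" using Kf(2)[OF xQ] K by simp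
    show "norm (f (x, y, u) - f (x, 0, u)) \<le> K * \<bar>y\<bar>"
      using f_near[OF xyu] mult_right_mono[OF K(3), of "\<bar>y\<bar>"] by simp
    show "\<bar>g (x, y, u) - g (x, 0, u)\<bar> \<le> K * \<bar>y\<bar>"
      using g_near[OF xyu] mult_right_mono[OF K(4), of "\<bar>y\<bar>"] by simp
  next
    fix x x' :: 'a assume "norm x \<le> M" "norm x' \<le> M"
    then show "norm (filippov_field f g x - filippov_field f g x') \<le> K * norm (x - x')"
      using lipschitz_onD[OF L(3), of x x'] mult_right_mono[OF K(5), of "norm (x - x')"]
      by (simp add: S_def dist_norm)
  next
    fix x :: 'a assume "norm x \<le> M"
    then have "x \<in> S" by (simp add: S_def)
    then show "norm (jump_ratio f g x) \<le> K" using Kj(2) K(2) by force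
    obtain D where D: "(jump_ratio f g has_derivative D) (at x)" "\<And>v. norm (D v) \<le> K\<^sub>j * norm v"
      using Kj(3)[OF \<open>x \<in> S\<close>] by blast
    have "norm (D v) \<le> K * norm v" for v
      using D(2)[of v] mult_right_mono[OF K(2), of "norm v"] by simp
    with D(1) show "\<exists>D. (jump_ratio f g has_derivative D) (at x) \<and> (\<forall>v. norm (D v) \<le> K * norm v)"
      by blast
  qed (use K \<eta> in auto)
  then show ?thesis by (rule that)
qed

section \<open>Existence by truncation and the estimate\<close>

text \<open>
  Composition with the nearest-point map of a compact convex set preserves Lipschitz constants, as this map
  is nonexpansive, and makes them global; values on the set are unchanged.
\<close>
definition truncate :: "('a::euclidean_space \<times> real) set \<Rightarrow> ('a \<times> real \<times> real \<Rightarrow> 'b) \<Rightarrow> 'a \<times> real \<times> real \<Rightarrow> 'b" where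
  "truncate S h = (\<lambda>(x, y, u). h (fst (closest_point S (x, y)), snd (closest_point S (x, y)), u))"

lemma truncate_eq: "(x, y) \<in> S \<Longrightarrow> truncate S h (x, y, u) = h (x, y, u)"
  by (simp add: truncate_def closest_point_self)

lemma truncate_lipschitz:
  assumes "L-lipschitz_on Q h" "\<And>x y. (x, y) \<in> S \<Longrightarrow> (x, y, u) \<in> Q"
    and S: "convex S" "closed S" "S \<noteq> {}"
  shows "L-lipschitz_on UNIV (\<lambda>(x, y). truncate S h (x, y, u))"
proof (rule lipschitz_onI)
  show "0 \<le> L" using assms(1) by (rule lipschitz_on_nonneg)
  fix p q :: "'a \<times> real"
  define P where "P = (\<lambda>p. (fst (closest_point S p), snd (closest_point S p), u))"
  have "P p \<in> Q" "P q \<in> Q"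
    using assms(2) closest_point_in_set[OF S(2,3)] by (auto simp: P_def)
  then have "dist (h (P p)) (h (P q)) \<le> L * dist (P p) (P q)"
    using lipschitz_onD[OF assms(1)] by blast
  also have "dist (P p) (P q) = dist (closest_point S p) (closest_point S q)"
    by (simp add: P_def dist_prod_def)
  also have "L * \<dots> \<le> L * dist p q"
    using \<open>0 \<le> L\<close> by (intro mult_left_mono closest_point_lipschitz S)
  finally show "dist (case p of (x, y) \<Rightarrow> truncate S h (x, y, u)) (case q of (x, y) \<Rightarrow> truncate S h (x, y, u))
      \<le> L * dist p q"
    by (simp add: P_def truncate_def case_prod_beta)
qed

lemma truncated_hysteretic_solution_exists:
  fixes f :: "'a::euclidean_space \<times> real \<times> real \<Rightarrow> 'a"
  assumes "smooth f" "smooth g" and S: "compact S" "convex S" "S \<noteq> {}"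
    and "0 < \<alpha>" "0 < T" "u\<^sub>0 \<in> {-1, 1}"
  shows "\<exists>x y. hysteretic_solution (truncate S f) (truncate S g) \<alpha> T u\<^sub>0 x y \<and> x 0 = x\<^sub>0"
proof -
  define Q where "Q = (\<lambda>((x, y), u). (x, y, u)) ` (S \<times> {-1..1::real})"
  have reassoc: "linear (\<lambda>((x::'a, y::real), u::real). (x, y, u))"
    by (auto intro!: linearI)
  have "compact Q"
    unfolding Q_def using reassoc S(1)
    by (intro compact_continuous_image compact_Times linear_continuous_on)
      (auto simp: linear_conv_bounded_linear)
  have "convex Q"
    unfolding Q_def by (intro convex_linear_image[OF reassoc] convex_Times S convex_real_interval)
  have mem_Q: "(x, y, u) \<in> Q" if "(x, y) \<in> S" "u \<in> {-1, 1}" for x y u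
    using that by (force simp: Q_def)
  obtain L\<^sub>f L\<^sub>g where L: "L\<^sub>f-lipschitz_on Q f" "L\<^sub>g-lipschitz_on Q g"
    using smooth_imp_bounded_deriv_on[OF _ \<open>compact Q\<close>] bounded_deriv_on_lipschitz[OF _ \<open>convex Q\<close>] assms(1,2)
    by metis
  obtain B where B: "0 < B" "\<And>p. p \<in> Q \<Longrightarrow> norm (g p) \<le> B"
    using smooth_imp_bounded_deriv_on[OF \<open>smooth g\<close> \<open>compact Q\<close>] unfolding bounded_deriv_on_def by blast
  have closed: "closed S" using S(1) by (rule compact_imp_closed)
  show ?thesis
  proof (rule hysteretic_solution_exists[OF _ B(1) _ \<open>0 < \<alpha>\<close> \<open>0 < T\<close> \<open>u\<^sub>0 \<in> {-1, 1}\<close>])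
    fix u :: real assume u: "u \<in> {-1, 1}"
    have "L\<^sub>f-lipschitz_on UNIV (\<lambda>(x, y). truncate S f (x, y, u))"
      "L\<^sub>g-lipschitz_on UNIV (\<lambda>(x, y). truncate S g (x, y, u))"
      using L mem_Q u S closed by (auto intro!: truncate_lipschitz)
    from lipschitz_on_Pair[OF this]
    show "\<exists>L. L-lipschitz_on UNIV (\<lambda>(x, y). (truncate S f (x, y, u), truncate S g (x, y, u)))"
      by (auto simp: case_prod_beta)
    show "\<bar>truncate S g (x, y, u)\<bar> \<le> B" for x y
      using B(2)[OF mem_Q[OF _ u]] closest_point_in_set[OF closed S(3), of "(x, y)"]
      by (simp add: truncate_def)
  qed
qed

theorem theorem1:
  fixes f :: "(real ^ 'm) \<times> real \<times> real \<Rightarrow> real ^ 'm"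
    and g :: "(real ^ 'm) \<times> real \<times> real \<Rightarrow> real"
    and M T :: real
    and x\<^sub>F :: "real \<Rightarrow> real ^ 'm"
  assumes "smooth f" and "smooth g"
    and "M > 0"
    and "\<And>x. norm x \<le> M \<Longrightarrow> g (x, 0, 1) < 0 \<and> 0 < g (x, 0, -1)"
    and "\<And>x u. norm x \<le> M \<Longrightarrow> u \<in> {-1..1} \<Longrightarrow> deriv (\<lambda>v. g (x, 0, v)) u < 0"
    and "T > 0"
    and "\<And>t. t \<in> {0..T} \<Longrightarrow>
           (x\<^sub>F has_vector_derivative filippov_field f g (x\<^sub>F t)) (at t within {0..T})"
    and "\<And>t. t \<in> {0..T} \<Longrightarrow> norm (x\<^sub>F t) < M"
  shows "\<exists>\<alpha>\<^sub>0>0. \<exists>L>0. \<forall>\<alpha>. 0 < \<alpha> \<and> \<alpha> \<le> \<alpha>\<^sub>0 \<longrightarrow>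
           (\<forall>u\<^sub>0\<in>{-1, 1}.
              (\<exists>x\<^sub>h y\<^sub>h. hysteretic_solution f g \<alpha> T u\<^sub>0 x\<^sub>h y\<^sub>h \<and> x\<^sub>h 0 = x\<^sub>F 0) \<and>
              (\<forall>x\<^sub>h y\<^sub>h. hysteretic_solution f g \<alpha> T u\<^sub>0 x\<^sub>h y\<^sub>h \<and> x\<^sub>h 0 = x\<^sub>F 0 \<longrightarrow>
                 (\<forall>t\<in>{0..T}. norm (x\<^sub>h t - x\<^sub>F t) \<le> L * \<alpha>)))"
proof -
  have sign: "\<And>x. norm x \<le> M \<Longrightarrow> g (x, 0, 1) < 0 \<and> 0 < g (x, 0, -1)"
    and slide: "\<And>t. t \<in> {0..T} \<Longrightarrow>
      (x\<^sub>F has_vector_derivative filippov_field f g (x\<^sub>F t)) (at t within {0..T})"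
    and xF: "\<And>t. t \<in> {0..T} \<Longrightarrow> norm (x\<^sub>F t) < M"
    using assms by blast+
  obtain \<eta> K where patch: "sliding_patch f g M \<eta> K"
    using sliding_patch_exists[OF \<open>smooth f\<close> \<open>smooth g\<close> \<open>M > 0\<close> sign] by blast
  interpret sliding_patch f g M \<eta> K by (rule patch)
  have "continuous_on {0..T} (\<lambda>t. norm (x\<^sub>F t))"
    using slide by (intro continuous_on_norm continuous_on_vector_derivative)
  then obtain t\<^sub>m where tm: "t\<^sub>m \<in> {0..T}" "\<And>t. t \<in> {0..T} \<Longrightarrow> norm (x\<^sub>F t) \<le> norm (x\<^sub>F t\<^sub>m)"
    using continuous_attains_sup[of "{0..T}" "\<lambda>t. norm (x\<^sub>F t)"] \<open>T > 0\<close> by auto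
  define \<delta> where "\<delta> = M - norm (x\<^sub>F t\<^sub>m)"
  have "0 < \<delta>" using xF[OF tm(1)] by (simp add: \<delta>_def)
  let ?L = "tracking_constant T"
  \<comment> \<open>the second bound keeps the error within half of the distance from \<open>x\<^sub>F\<close> to the sphere\<close>
  define \<alpha>\<^sub>0 where "\<alpha>\<^sub>0 = min \<eta> (\<delta> / (2 * ?L))"
  have "0 < \<alpha>\<^sub>0" using \<eta>_pos \<open>0 < \<delta>\<close> tracking_constant_pos by (simp add: \<alpha>\<^sub>0_def)
  define S where "S = cball (0 :: real ^ 'm) M \<times> cball (0 :: real) \<eta>"
  have S: "compact S" "convex S" "S \<noteq> {}"
    using \<open>M > 0\<close> \<eta>_pos by (auto simp: S_def compact_Times convex_Times)
  have track: "norm (x t) \<le> M \<and> \<bar>y t\<bar> \<le> \<alpha> \<and> norm (x t - x\<^sub>F t) \<le> ?L * \<alpha>"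
    if "hysteretic_solution f' g' \<alpha> T u\<^sub>0 x y"
      and "\<And>x y u. norm x \<le> M \<Longrightarrow> \<bar>y\<bar> \<le> \<eta> \<Longrightarrow> u \<in> {-1, 1} \<Longrightarrow>
        f' (x, y, u) = f (x, y, u) \<and> g' (x, y, u) = g (x, y, u)"
      and "0 < \<alpha>" "\<alpha> \<le> \<alpha>\<^sub>0" "u\<^sub>0 \<in> {-1, 1}" "x 0 = x\<^sub>F 0" "t \<in> {0..T}" for f' g' \<alpha> u\<^sub>0 x y t
  proof (rule tracking[OF that(1,2,3) _ that(5,6) slide _ that(7)])
    show "\<alpha> \<le> \<eta>" using that(4) by (simp add: \<alpha>\<^sub>0_def)
    have "?L * \<alpha> \<le> ?L * (\<delta> / (2 * ?L))"
      using that(4) tracking_constant_pos by (intro mult_left_mono) (auto simp: \<alpha>\<^sub>0_def less_imp_le)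
    also have "\<dots> < \<delta>" using \<open>0 < \<delta>\<close> tracking_constant_pos[of T] by simp
    finally show "norm (x\<^sub>F s) + ?L * \<alpha> < M" if "s \<in> {0..T}" for s
      using tm(2)[OF that] by (simp add: \<delta>_def)
  qed
  have "\<forall>\<alpha>. 0 < \<alpha> \<and> \<alpha> \<le> \<alpha>\<^sub>0 \<longrightarrow>
      (\<forall>u\<^sub>0\<in>{-1, 1}.
         (\<exists>x y. hysteretic_solution f g \<alpha> T u\<^sub>0 x y \<and> x 0 = x\<^sub>F 0) \<and>
         (\<forall>x y. hysteretic_solution f g \<alpha> T u\<^sub>0 x y \<and> x 0 = x\<^sub>F 0 \<longrightarrow>
            (\<forall>t\<in>{0..T}. norm (x t - x\<^sub>F t) \<le> ?L * \<alpha>)))"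
  proof (intro conjI allI impI ballI)
    fix \<alpha> u\<^sub>0 :: real
    assume \<alpha>: "0 < \<alpha> \<and> \<alpha> \<le> \<alpha>\<^sub>0" and u\<^sub>0: "u\<^sub>0 \<in> {-1, 1}"
    obtain x y where xy: "hysteretic_solution (truncate S f) (truncate S g) \<alpha> T u\<^sub>0 x y" "x 0 = x\<^sub>F 0"
      using truncated_hysteretic_solution_exists[OF \<open>smooth f\<close> \<open>smooth g\<close> S _ \<open>T > 0\<close> u\<^sub>0] \<alpha> by blast
    have agree: "truncate S f (x, y, u) = f (x, y, u) \<and> truncate S g (x, y, u) = g (x, y, u)"
      if "norm x \<le> M" "\<bar>y\<bar> \<le> \<eta>" for x y u
      using that by (simp add: truncate_eq S_def)
    \<comment> \<open>the truncated system's solution stays where truncation changes nothing\<close>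
    have "norm (x t) \<le> M \<and> \<bar>y t\<bar> \<le> \<eta>" if "t \<in> {0..T}" for t
      using track[OF xy(1) agree _ _ u\<^sub>0 xy(2) that] \<alpha> by (auto simp: \<alpha>\<^sub>0_def)
    then have "hysteretic_solution f g \<alpha> T u\<^sub>0 x y"
      by (intro hysteretic_solution_cong[OF xy(1) u\<^sub>0] agree) auto
    with xy(2) show "\<exists>x y. hysteretic_solution f g \<alpha> T u\<^sub>0 x y \<and> x 0 = x\<^sub>F 0" by blast
  next
    fix \<alpha> u\<^sub>0 t :: real and x y
    assume \<alpha>: "0 < \<alpha> \<and> \<alpha> \<le> \<alpha>\<^sub>0" and "u\<^sub>0 \<in> {-1, 1}"
      and "hysteretic_solution f g \<alpha> T u\<^sub>0 x y \<and> x 0 = x\<^sub>F 0" "t \<in> {0..T}"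
    then show "norm (x t - x\<^sub>F t) \<le> ?L * \<alpha>"
      using track[of f g \<alpha> u\<^sub>0 x y t] by blast
  qed
  with \<open>0 < \<alpha>\<^sub>0\<close> tracking_constant_pos show ?thesis by blast
qed

end
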